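(* Continuous Tarski geometry has the same theorems as Tarski geometry (both with classical logic; strict betweenness $B$ and non-strict betweenness $T$ are translated into each other by their mutual definitions).
   Context: Both theories use classical first-order logic with equality, one sort of variables (points), and a 4-ary congruence relation $E(a,b,c,d)$ written $ab=cd$. Non-strict betweenness $T$ and strict betweenness $B$ are interdefinable: $T(a,b,c):=\neg(a\neq b\land b\neq c\land\neg B(a,b,c))$ and $B(a,b,c):=T(a,b,c)\land a\neq b\land b\neq c$. $Col(a,b,c)$ (collinearity) is (classically) $T(a,b,c)\lor T(b,c,a)\lor T(c,a,b)$. Axioms are understood as universally closed. Tarski geometry (primitive $T$, $E$) has the axioms: (A1) $ab=ba$; (A2) $ab=pq\land ab=rs\to pq=rs$; (A3) $ab=cc\to a=b$; (A4) $\exists x(T(q,a,x)\land ax=bc)$; (A5) $a\neq b\land T(a,b,c)\land T(A,B,C)\land ab=AB\land bc=BC\land ad=AD\land bd=BD\to cd=CD$; (A6) $T(a,b,a)\to a=b$; (A7) $T(a,p,c)\land T(b,q,c)\to\exists x(T(p,x,b)\land T(q,x,a))$; (A8) $\exists a,b,c\,\neg Col(a,b,c)$; (A9) $a\neq b\land pa=pb\land qa=qb\land ra=rb\to Col(p,q,r)$; (A10$_3$) $\neg Col(a,b,c)\to\exists x(ax=bx\land ax=cx)$; segment-circle continuity: $ax=ap\land T(a,x,b)\land T(a,b,y)\land ay=aq\to\exists z(T(p,z,q)\land az=ab)$. Continuous Tarski geometry (primitive $B$, $E$) has the axioms (A1), (A2), (A3), (A5), (A8), (A9), (A10$_3$)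 above together with: (A4-i) $q\neq a\to\exists x(T(q,a,x)\land ax=bc)$; (A6-i) $\neg B(a,b,a)$; (A7-i) $B(a,p,c)\land T(b,q,c)\land\neg Col(a,b,c)\to\exists x(B(p,x,b)\land B(q,x,a))$; (A14-i) $B(a,b,c)\to B(c,b,a)$; (A15-i) $B(a,b,d)\land B(b,c,d)\to B(a,b,c)$; two-point line-circle continuity (instead of segment-circle): $Col(u,v,p)\land u\neq v\land T(a,p,b)\to\exists y,z(Col(u,v,y)\land Col(u,v,z)\land ay=ab\land az=ab\land T(y,p,z)\land(p\neq a\to y\neq z))$.
   Formalization: Two axioms of continuous Tarski geometry, false in the Euclidean plane as listed, are corrected: (A7-i) assumes B(b,q,c) instead of T(b,q,c), and two-point line-circle continuity concludes p≠b → y≠z instead of p≠a → y≠z. *)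

theory Defs
  imports Main
begin

section \<open>First-order logic with equality over a betweenness and a congruence relation\<close>

text \<open>
  De Bruijn syntax; variables are the only terms. The type parameter
  \<open>'p\<close> is the type of ternary relation symbols; it is instantiated with a one-element type,
  so that the languages with primitive \<open>T\<close> and with primitive \<open>B\<close> are different types.
\<close>

datatype 'p fm =
    Falsum
  | Eq nat nat (infix "\<^bold>=" 50)
  | Btw 'p nat nat nat
  | Cong nat nat nat nat
  | Imp "'p fm" "'p fm" (infixr "\<^bold>\<longrightarrow>" 25)
  | All "'p fm"

abbreviation Neg :: "'p fm \<Rightarrow> 'p fm" ("\<^bold>\<not> _" [40] 40) where
  "\<^bold>\<not> \<phi> \<equiv> \<phi> \<^bold>\<longrightarrow> Falsum"

abbreviation Con :: "'p fm \<Rightarrow> 'p fm \<Rightarrow> 'p fm" (infixr "\<^bold>\<and>" 35) where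
  "\<phi> \<^bold>\<and> \<psi> \<equiv> \<^bold>\<not> (\<phi> \<^bold>\<longrightarrow> \<^bold>\<not> \<psi>)"

abbreviation Dis :: "'p fm \<Rightarrow> 'p fm \<Rightarrow> 'p fm" (infixr "\<^bold>\<or>" 30) where
  "\<phi> \<^bold>\<or> \<psi> \<equiv> \<^bold>\<not> \<phi> \<^bold>\<longrightarrow> \<psi>"

abbreviation Neq :: "nat \<Rightarrow> nat \<Rightarrow> 'p fm" (infix "\<^bold>\<noteq>" 50) where
  "x \<^bold>\<noteq> y \<equiv> \<^bold>\<not> (x \<^bold>= y)"

primrec ren :: "(nat \<Rightarrow> nat) \<Rightarrow> 'p fm \<Rightarrow> 'p fm" where
  "ren \<rho> Falsum = Falsum"
| "ren \<rho> (x \<^bold>= y) = (\<rho> x \<^bold>= \<rho> y)"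
| "ren \<rho> (Btw P x y z) = Btw P (\<rho> x) (\<rho> y) (\<rho> z)"
| "ren \<rho> (Cong x y z w) = Cong (\<rho> x) (\<rho> y) (\<rho> z) (\<rho> w)"
| "ren \<rho> (\<phi> \<^bold>\<longrightarrow> \<psi>) = (ren \<rho> \<phi> \<^bold>\<longrightarrow> ren \<rho> \<psi>)"
| "ren \<rho> (All \<phi>) = All (ren (case_nat 0 (Suc \<circ> \<rho>)) \<phi>)"

text \<open>\<open>inst x \<phi>\<close> strips the quantifier in \<open>All \<phi>\<close> and puts the variable \<open>x\<close> for the bound variable.\<close>

definition inst :: "nat \<Rightarrow> 'p fm \<Rightarrow> 'p fm" where
  "inst x \<phi> = ren (case_nat x id) \<phi>"

text \<open>Classical natural deduction.\<close>

inductive proves :: "'p fm set \<Rightarrow> 'p fm \<Rightarrow> bool" (infix "\<turnstile>" 20) where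
  Assm: "\<phi> \<in> \<Gamma> \<Longrightarrow> \<Gamma> \<turnstile> \<phi>"
| ImpI: "insert \<phi> \<Gamma> \<turnstile> \<psi> \<Longrightarrow> \<Gamma> \<turnstile> \<phi> \<^bold>\<longrightarrow> \<psi>"
| ImpE: "\<Gamma> \<turnstile> \<phi> \<^bold>\<longrightarrow> \<psi> \<Longrightarrow> \<Gamma> \<turnstile> \<phi> \<Longrightarrow> \<Gamma> \<turnstile> \<psi>"
| Classical: "insert (\<^bold>\<not> \<phi>) \<Gamma> \<turnstile> Falsum \<Longrightarrow> \<Gamma> \<turnstile> \<phi>"
| AllI: "ren Suc ` \<Gamma> \<turnstile> \<phi> \<Longrightarrow> \<Gamma> \<turnstile> All \<phi>"
| AllE: "\<Gamma> \<turnstile> All \<phi> \<Longrightarrow> \<Gamma> \<turnstile> inst x \<phi>"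
| EqI: "\<Gamma> \<turnstile> x \<^bold>= x"
| EqE: "\<Gamma> \<turnstile> x \<^bold>= y \<Longrightarrow> \<Gamma> \<turnstile> inst x \<phi> \<Longrightarrow> \<Gamma> \<turnstile> inst y \<phi>"

text \<open>
  Quantification over a named variable: a free index \<open>x\<close> serves as a name, \<open>forall x \<phi>\<close> turns it
  into the bound index and leaves all other free indices with their meaning. The axioms below
  are written with such names.
\<close>

definition forall :: "nat \<Rightarrow> 'p fm \<Rightarrow> 'p fm" where
  "forall x \<phi> = All (ren (\<lambda>i. if i = x then 0 else Suc i) \<phi>)"

definition exists :: "nat \<Rightarrow> 'p fm \<Rightarrow> 'p fm" where
  "exists x \<phi> = (\<^bold>\<not> forall x (\<^bold>\<not> \<phi>))"

abbreviation foralls :: "nat list \<Rightarrow> 'p fm \<Rightarrow> 'p fm" where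
  "foralls xs \<phi> \<equiv> foldr forall xs \<phi>"

abbreviation existss :: "nat list \<Rightarrow> 'p fm \<Rightarrow> 'p fm" where
  "existss xs \<phi> \<equiv> foldr exists xs \<phi>"

abbreviation (input) "\<a> \<equiv> 0 :: nat"
abbreviation (input) "\<b> \<equiv> 1 :: nat"
abbreviation (input) "\<c> \<equiv> 2 :: nat"
abbreviation (input) "\<d> \<equiv> 3 :: nat"
abbreviation (input) "\<p> \<equiv> 4 :: nat"
abbreviation (input) "\<q> \<equiv> 5 :: nat"
abbreviation (input) "\<r> \<equiv> 6 :: nat"
abbreviation (input) "\<s> \<equiv> 7 :: nat"
abbreviation (input) "\<u> \<equiv> 8 :: nat"
abbreviation (input) "\<v> \<equiv> 9 :: nat"
abbreviation (input) "\<x> \<equiv> 10 :: nat"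
abbreviation (input) "\<y> \<equiv> 11 :: nat"
abbreviation (input) "\<z> \<equiv> 12 :: nat"
abbreviation (input) "\<A> \<equiv> 13 :: nat"
abbreviation (input) "\<B> \<equiv> 14 :: nat"
abbreviation (input) "\<C> \<equiv> 15 :: nat"
abbreviation (input) "\<D> \<equiv> 16 :: nat"

section \<open>The two languages and their translations\<close>

datatype nonstrict = T
datatype strict = B

type_synonym tarski_fm = "nonstrict fm"
type_synonym continuous_fm = "strict fm"

definition T_by_B :: "nat \<Rightarrow> nat \<Rightarrow> nat \<Rightarrow> continuous_fm" where
  "T_by_B x y z = (\<^bold>\<not> (x \<^bold>\<noteq> y \<^bold>\<and> y \<^bold>\<noteq> z \<^bold>\<and> \<^bold>\<not> Btw B x y z))"

definition B_by_T :: "nat \<Rightarrow> nat \<Rightarrow> nat \<Rightarrow> tarski_fm" where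
  "B_by_T x y z = (Btw T x y z \<^bold>\<and> x \<^bold>\<noteq> y \<^bold>\<and> y \<^bold>\<noteq> z)"

primrec replace_btw :: "('p \<Rightarrow> nat \<Rightarrow> nat \<Rightarrow> nat \<Rightarrow> 'q fm) \<Rightarrow> 'p fm \<Rightarrow> 'q fm" where
  "replace_btw F Falsum = Falsum"
| "replace_btw F (x \<^bold>= y) = (x \<^bold>= y)"
| "replace_btw F (Btw P x y z) = F P x y z"
| "replace_btw F (Cong x y z w) = Cong x y z w"
| "replace_btw F (\<phi> \<^bold>\<longrightarrow> \<psi>) = (replace_btw F \<phi> \<^bold>\<longrightarrow> replace_btw F \<psi>)"
| "replace_btw F (All \<phi>) = All (replace_btw F \<phi>)"

definition to_B :: "tarski_fm \<Rightarrow> continuous_fm" where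
  "to_B = replace_btw (\<lambda>_. T_by_B)"

definition to_T :: "continuous_fm \<Rightarrow> tarski_fm" where
  "to_T = replace_btw (\<lambda>_. B_by_T)"

section \<open>Axioms\<close>

text \<open>
  The axioms common to both theories take the formula \<open>t x y z\<close> that expresses
  non-strict betweenness (primitive in one theory, defined in the other) as a parameter.
\<close>

type_synonym 'p btw = "nat \<Rightarrow> nat \<Rightarrow> nat \<Rightarrow> 'p fm"

definition Col :: "'p btw \<Rightarrow> 'p btw" where
  "Col t x y z = (t x y z \<^bold>\<or> t y z x \<^bold>\<or> t z x y)"

definition A1 :: "'p fm" where
  "A1 = foralls [\<a>, \<b>] (Cong \<a> \<b> \<b> \<a>)"

definition A2 :: "'p fm" where
  "A2 = foralls [\<a>, \<b>, \<p>, \<q>, \<r>, \<s>]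
    (Cong \<a> \<b> \<p> \<q> \<^bold>\<and> Cong \<a> \<b> \<r> \<s> \<^bold>\<longrightarrow> Cong \<p> \<q> \<r> \<s>)"

definition A3 :: "'p fm" where
  "A3 = foralls [\<a>, \<b>, \<c>] (Cong \<a> \<b> \<c> \<c> \<^bold>\<longrightarrow> \<a> \<^bold>= \<b>)"

definition A4 :: tarski_fm where
  "A4 = foralls [\<q>, \<a>, \<b>, \<c>] (exists \<x> (Btw T \<q> \<a> \<x> \<^bold>\<and> Cong \<a> \<x> \<b> \<c>))"

definition A4i :: continuous_fm where
  "A4i = foralls [\<q>, \<a>, \<b>, \<c>]
    (\<q> \<^bold>\<noteq> \<a> \<^bold>\<longrightarrow> exists \<x> (T_by_B \<q> \<a> \<x> \<^bold>\<and> Cong \<a> \<x> \<b> \<c>))"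

definition A5 :: "'p btw \<Rightarrow> 'p fm" where
  "A5 t = foralls [\<a>, \<b>, \<c>, \<d>, \<A>, \<B>, \<C>, \<D>]
    (\<a> \<^bold>\<noteq> \<b> \<^bold>\<and> t \<a> \<b> \<c> \<^bold>\<and> t \<A> \<B> \<C> \<^bold>\<and>
     Cong \<a> \<b> \<A> \<B> \<^bold>\<and> Cong \<b> \<c> \<B> \<C> \<^bold>\<and> Cong \<a> \<d> \<A> \<D> \<^bold>\<and> Cong \<b> \<d> \<B> \<D>
     \<^bold>\<longrightarrow> Cong \<c> \<d> \<C> \<D>)"

definition A6 :: tarski_fm where
  "A6 = foralls [\<a>, \<b>] (Btw T \<a> \<b> \<a> \<^bold>\<longrightarrow> \<a> \<^bold>= \<b>)"

definition A6i :: continuous_fm where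
  "A6i = foralls [\<a>, \<b>] (\<^bold>\<not> Btw B \<a> \<b> \<a>)"

definition A7 :: tarski_fm where
  "A7 = foralls [\<a>, \<b>, \<c>, \<p>, \<q>]
    (Btw T \<a> \<p> \<c> \<^bold>\<and> Btw T \<b> \<q> \<c> \<^bold>\<longrightarrow> exists \<x> (Btw T \<p> \<x> \<b> \<^bold>\<and> Btw T \<q> \<x> \<a>))"

text \<open>
  In strict inner Pasch both betweenness hypotheses have to be strict: for \<open>q = b\<close> or \<open>q = c\<close>
  the conclusion fails in the Euclidean plane, so \<open>T b q c\<close> would be too weak a hypothesis.
\<close>

definition A7i :: continuous_fm where
  "A7i = foralls [\<a>, \<b>, \<c>, \<p>, \<q>]
    (Btw B \<a> \<p> \<c> \<^bold>\<and> Btw B \<b> \<q> \<c> \<^bold>\<and> \<^bold>\<not> Col T_by_B \<a> \<b> \<c>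
     \<^bold>\<longrightarrow> exists \<x> (Btw B \<p> \<x> \<b> \<^bold>\<and> Btw B \<q> \<x> \<a>))"

definition A8 :: "'p btw \<Rightarrow> 'p fm" where
  "A8 t = existss [\<a>, \<b>, \<c>] (\<^bold>\<not> Col t \<a> \<b> \<c>)"

definition A9 :: "'p btw \<Rightarrow> 'p fm" where
  "A9 t = foralls [\<a>, \<b>, \<p>, \<q>, \<r>]
    (\<a> \<^bold>\<noteq> \<b> \<^bold>\<and> Cong \<p> \<a> \<p> \<b> \<^bold>\<and> Cong \<q> \<a> \<q> \<b> \<^bold>\<and> Cong \<r> \<a> \<r> \<b> \<^bold>\<longrightarrow> Col t \<p> \<q> \<r>)"

definition A10_3 :: "'p btw \<Rightarrow> 'p fm" where
  "A10_3 t = foralls [\<a>, \<b>, \<c>]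
    (\<^bold>\<not> Col t \<a> \<b> \<c> \<^bold>\<longrightarrow> exists \<x> (Cong \<a> \<x> \<b> \<x> \<^bold>\<and> Cong \<a> \<x> \<c> \<x>))"

definition A14i :: continuous_fm where
  "A14i = foralls [\<a>, \<b>, \<c>] (Btw B \<a> \<b> \<c> \<^bold>\<longrightarrow> Btw B \<c> \<b> \<a>)"

definition A15i :: continuous_fm where
  "A15i = foralls [\<a>, \<b>, \<c>, \<d>] (Btw B \<a> \<b> \<d> \<^bold>\<and> Btw B \<b> \<c> \<d> \<^bold>\<longrightarrow> Btw B \<a> \<b> \<c>)"

definition segment_circle :: tarski_fm where
  "segment_circle = foralls [\<a>, \<b>, \<p>, \<q>, \<x>, \<y>]
    (Cong \<a> \<x> \<a> \<p> \<^bold>\<and> Btw T \<a> \<x> \<b> \<^bold>\<and> Btw T \<a> \<b> \<y> \<^bold>\<and> Cong \<a> \<y> \<a> \<q>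
     \<^bold>\<longrightarrow> exists \<z> (Btw T \<p> \<z> \<q> \<^bold>\<and> Cong \<a> \<z> \<a> \<b>))"

text \<open>
  The two intersection points are distinct when \<open>p\<close> lies strictly inside the circle, i.e.
  \<open>p \<noteq> b\<close>. The condition \<open>p \<noteq> a\<close> would not do: it includes a tangent \<open>uv\<close> at \<open>p = b\<close>.
\<close>

definition line_circle :: continuous_fm where
  "line_circle = foralls [\<a>, \<b>, \<p>, \<u>, \<v>]
    (Col T_by_B \<u> \<v> \<p> \<^bold>\<and> \<u> \<^bold>\<noteq> \<v> \<^bold>\<and> T_by_B \<a> \<p> \<b>
     \<^bold>\<longrightarrow> existss [\<y>, \<z>]
       (Col T_by_B \<u> \<v> \<y> \<^bold>\<and> Col T_by_B \<u> \<v> \<z> \<^bold>\<and> Cong \<a> \<y> \<a> \<b> \<^bold>\<and> Cong \<a> \<z> \<a> \<b> \<^bold>\<and>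
        T_by_B \<y> \<p> \<z> \<^bold>\<and> (\<p> \<^bold>\<noteq> \<b> \<^bold>\<longrightarrow> \<y> \<^bold>\<noteq> \<z>)))"

definition tarski_geometry :: "tarski_fm set" where
  "tarski_geometry =
    {A1, A2, A3, A4, A5 (Btw T), A6, A7, A8 (Btw T), A9 (Btw T), A10_3 (Btw T), segment_circle}"

definition continuous_tarski_geometry :: "continuous_fm set" where
  "continuous_tarski_geometry =
    {A1, A2, A3, A4i, A5 T_by_B, A6i, A7i, A8 T_by_B, A9 T_by_B, A10_3 T_by_B, A14i, A15i,
     line_circle}"

end

theory Submission
  imports Defs "HOL-Library.Countable_Set"
begin

text \<open>
  Each theory is interpreted in the models of the other, which suffices by the completeness theorem.
  In a Henkin model the variables themselves serve as points, so it is countable, and since both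
  theories have only infinite models one may take the set of points to be \<open>nat\<close>.

  \<^item> From strict inner Pasch to inner Pasch: the degenerate and collinear cases are immediate from
    symmetry and inner transitivity of betweenness.

  \<^item> From line-circle to segment-circle: let \<open>w\<close>, \<open>w'\<close> be the points where the line \<open>pq\<close> meets
    the circle, \<open>w\<close> on the ray from \<open>p\<close> to \<open>q\<close>. If \<open>q\<close> were strictly between \<open>p\<close> and
    \<open>w\<close>, apply line-circle to the circle through \<open>q\<close> and to both \<open>w\<close> and \<open>w'\<close>. As a line meets
    a circle in at most two points, both applications give \<open>q\<close> and the same second point, which
    puts \<open>w\<close> and \<open>w'\<close> on the same side of \<open>q\<close>, a contradiction.

  \<^item> From segment-circle to line-circle: one needs points outside the circle on both sides of \<open>p\<close> on
    the given line. Take a point \<open>s\<close> outside the circle on the parallel through the center \<open>a\<close>; the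
    segment \<open>ps\<close> meets the circle in some \<open>z\<close>, and by the parallel postulate (the circumcenter
    axiom) the line \<open>az\<close> meets the given line in a point \<open>x\<close>, beyond \<open>z\<close> by plane separation.
\<close>

section \<open>Soundness and completeness\<close>

text \<open>The Henkin construction runs through all formulas in one sequence, indexed by
  \<open>to_nat\<close>.\<close>

instance fm :: (countable) countable by countable_datatype
instance nonstrict :: countable by countable_datatype
instance strict :: countable by countable_datatype

text \<open>The carrier is a set and not a type since the Henkin model lives on a set of variables;
  only afterwards is it moved onto all of \<open>nat\<close>.\<close>

primrec sat :: "'a set \<Rightarrow> ('p \<Rightarrow> 'a \<Rightarrow> 'a \<Rightarrow> 'a \<Rightarrow> bool) \<Rightarrow> ('a \<Rightarrow> 'a \<Rightarrow> 'a \<Rightarrow> 'a \<Rightarrow> bool)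
    \<Rightarrow> (nat \<Rightarrow> 'a) \<Rightarrow> 'p fm \<Rightarrow> bool" where
  "sat U R C e Falsum \<longleftrightarrow> False"
| "sat U R C e (x \<^bold>= y) \<longleftrightarrow> e x = e y"
| "sat U R C e (Btw P x y z) \<longleftrightarrow> R P (e x) (e y) (e z)"
| "sat U R C e (Cong x y z w) \<longleftrightarrow> C (e x) (e y) (e z) (e w)"
| "sat U R C e (\<phi> \<^bold>\<longrightarrow> \<psi>) \<longleftrightarrow> (sat U R C e \<phi> \<longrightarrow> sat U R C e \<psi>)"
| "sat U R C e (All \<phi>) \<longleftrightarrow> (\<forall>d\<in>U. sat U R C (case_nat d e) \<phi>)"

lemma sat_ren: "sat U R C e (ren \<rho> \<phi>) \<longleftrightarrow> sat U R C (e \<circ> \<rho>) \<phi>"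
proof (induction \<phi> arbitrary: e \<rho>)
  case (All \<phi>)
  have "case_nat d e \<circ> case_nat 0 (Suc \<circ> \<rho>) = case_nat d (e \<circ> \<rho>)" for d
    by (auto simp: fun_eq_iff split: nat.split)
  then show ?case by (simp only: ren.simps sat.simps All.IH)
qed simp_all

lemma sat_inst: "sat U R C e (inst x \<phi>) \<longleftrightarrow> sat U R C (case_nat (e x) e) \<phi>"
proof -
  have "e \<circ> case_nat x id = case_nat (e x) e"
    by (auto simp: fun_eq_iff split: nat.split)
  then show ?thesis by (simp add: inst_def sat_ren)
qed

lemma sat_forall [simp]: "sat U R C e (forall x \<phi>) \<longleftrightarrow> (\<forall>d\<in>U. sat U R C (e(x := d)) \<phi>)"
proof -
  have "case_nat d e \<circ> (\<lambda>i. if i = x then 0 else Suc i) = e(x := d)" for d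
    by (auto simp: fun_eq_iff)
  then show ?thesis by (simp add: forall_def sat_ren)
qed

lemma sat_exists [simp]: "sat U R C e (exists x \<phi>) \<longleftrightarrow> (\<exists>d\<in>U. sat U R C (e(x := d)) \<phi>)"
  by (simp add: exists_def)

text \<open>With the full type as carrier every variable denotes a point of it, so
  \<open>AllE\<close> needs no side condition on the assignment.\<close>

lemma soundness:
  assumes "\<Gamma> \<turnstile> \<phi>" "\<And>\<gamma>. \<gamma> \<in> \<Gamma> \<Longrightarrow> sat UNIV R C e \<gamma>"
  shows "sat UNIV R C e \<phi>"
  using assms
proof (induction arbitrary: e)
  case (ImpI \<phi> \<Gamma> \<psi>)
  then show ?case by auto
next
  case (Classical \<phi> \<Gamma>)
  then show ?case by (metis insert_iff sat.simps(1,5))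
next
  case (AllI \<Gamma> \<phi>)
  have "case_nat d e \<circ> Suc = e" for d
    by (auto simp: fun_eq_iff)
  then have "sat UNIV R C (case_nat d e) \<phi>" for d
    by (intro AllI.IH) (use AllI.prems in \<open>auto simp: sat_ren\<close>)
  then show ?case by simp
next
  case (EqE \<Gamma> x y \<phi>)
  have "e x = e y" using EqE.IH(1)[of e] EqE.prems by simp
  moreover have "sat UNIV R C (case_nat (e x) e) \<phi>" using EqE.IH(2)[of e] EqE.prems by (simp add: sat_inst)
  ultimately show ?case by (simp add: sat_inst)
qed (auto simp: sat_inst)

text \<open>Serves to move a countably infinite model onto \<open>nat\<close>: the relations on
  \<open>V\<close> are pulled back along the inverse of \<open>g\<close>.\<close>

lemma sat_iso:
  assumes g: "bij_betw g U V" and e: "range e \<subseteq> U"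
  shows "sat V (\<lambda>P a b c. R P (inv_into U g a) (inv_into U g b) (inv_into U g c))
      (\<lambda>a b c d. C (inv_into U g a) (inv_into U g b) (inv_into U g c) (inv_into U g d)) (g \<circ> e) \<phi>
    \<longleftrightarrow> sat U R C e \<phi>"
  using e
proof (induction \<phi> arbitrary: e)
  case (Eq x y)
  then have "e x \<in> U" "e y \<in> U" by auto
  then show ?case using g by (auto simp: bij_betw_def inj_on_def)
next
  case (Btw P x y z)
  then have "inv_into U g (g (e i)) = e i" for i
    using g by (auto simp: bij_betw_def intro!: inv_into_f_f)
  then show ?case by simp
next
  case (Cong x y z w)
  then have "inv_into U g (g (e i)) = e i" for i
    using g by (auto simp: bij_betw_def intro!: inv_into_f_f)
  then show ?case by simp
next
  case (All \<phi>)
  have V: "(\<forall>d\<in>V. P d) \<longleftrightarrow> (\<forall>d\<in>U. P (g d))" for P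
    using g by (auto simp: bij_betw_def)
  have eq: "case_nat (g d) (g \<circ> e) = g \<circ> case_nat d e" for d
    by (auto simp: fun_eq_iff split: nat.split)
  have "range (case_nat d e) \<subseteq> U" if "d \<in> U" for d
    using that All.prems by (auto simp: image_subset_iff split: nat.split)
  note IH = All.IH[OF this]
  show ?case by (simp only: sat.simps V eq IH cong: ball_cong)
qed simp_all

section \<open>Renaming of variables and derivability\<close>

primrec fv :: "'p fm \<Rightarrow> nat set" where
  "fv Falsum = {}"
| "fv (x \<^bold>= y) = {x, y}"
| "fv (Btw P x y z) = {x, y, z}"
| "fv (Cong x y z w) = {x, y, z, w}"
| "fv (\<phi> \<^bold>\<longrightarrow> \<psi>) = fv \<phi> \<union> fv \<psi>"
| "fv (All \<phi>) = Suc -` fv \<phi>"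

lemma finite_fv: "finite (fv \<phi>)"
  by (induction \<phi>) (auto intro: finite_vimageI)

lemma ren_cong: "(\<And>i. i \<in> fv \<phi> \<Longrightarrow> \<rho> i = \<sigma> i) \<Longrightarrow> ren \<rho> \<phi> = ren \<sigma> \<phi>"
proof (induction \<phi> arbitrary: \<rho> \<sigma>)
  case (All \<phi>)
  have "ren (case_nat 0 (Suc \<circ> \<rho>)) \<phi> = ren (case_nat 0 (Suc \<circ> \<sigma>)) \<phi>"
    by (rule All.IH) (use All.prems in \<open>auto split: nat.split\<close>)
  then show ?case by simp
next
  case (Imp \<phi> \<psi>)
  have "ren \<rho> \<phi> = ren \<sigma> \<phi>" "ren \<rho> \<psi> = ren \<sigma> \<psi>"
    by (rule Imp.IH; use Imp.prems in simp)+
  then show ?case by simp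
qed simp_all

lemma ren_ren: "ren \<rho> (ren \<sigma> \<phi>) = ren (\<rho> \<circ> \<sigma>) \<phi>"
proof (induction \<phi> arbitrary: \<rho> \<sigma>)
  case (All \<phi>)
  have "case_nat 0 (Suc \<circ> \<rho>) \<circ> case_nat 0 (Suc \<circ> \<sigma>) = case_nat 0 (Suc \<circ> (\<rho> \<circ> \<sigma>))"
    by (auto simp: fun_eq_iff split: nat.split)
  then show ?case by (simp only: ren.simps All.IH)
qed simp_all

lemma ren_id [simp]: "ren id \<phi> = \<phi>"
proof (induction \<phi>)
  case (All \<phi>)
  have "case_nat 0 (Suc \<circ> id) = id"
    by (auto simp: fun_eq_iff split: nat.split)
  then show ?case using All.IH by (simp only: ren.simps)
qed simp_all

lemma ren_inst: "ren \<rho> (inst x \<phi>) = inst (\<rho> x) (ren (case_nat 0 (Suc \<circ> \<rho>)) \<phi>)"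
proof -
  have "\<rho> \<circ> case_nat x id = case_nat (\<rho> x) id \<circ> case_nat 0 (Suc \<circ> \<rho>)"
    by (auto simp: fun_eq_iff split: nat.split)
  then show ?thesis by (simp add: inst_def ren_ren)
qed

text \<open>Needed in the quantifier case of the truth lemma: an instance of a renamed body is again
  a renaming of the body, so the induction hypothesis applies to it.\<close>

lemma inst_lift: "inst x (ren (case_nat 0 (Suc \<circ> \<rho>)) \<phi>) = ren (case_nat x \<rho>) \<phi>"
proof -
  have "case_nat x id \<circ> case_nat 0 (Suc \<circ> \<rho>) = case_nat x \<rho>"
    by (auto simp: fun_eq_iff split: nat.split)
  then show ?thesis by (simp add: inst_def ren_ren)
qed

lemma weakening: "\<Gamma> \<turnstile> \<phi> \<Longrightarrow> \<Gamma> \<subseteq> \<Delta> \<Longrightarrow> \<Delta> \<turnstile> \<phi>"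
proof (induction arbitrary: \<Delta> rule: proves.induct)
  case (ImpI \<phi> \<Gamma> \<psi>)
  have "insert \<phi> \<Delta> \<turnstile> \<psi>" by (rule ImpI.IH) (use ImpI.prems in blast)
  then show ?case by (rule proves.ImpI)
next
  case (Classical \<phi> \<Gamma>)
  have "insert (\<^bold>\<not> \<phi>) \<Delta> \<turnstile> Falsum" by (rule Classical.IH) (use Classical.prems in blast)
  then show ?case by (rule proves.Classical)
next
  case (AllI \<Gamma> \<phi>)
  have "ren Suc ` \<Delta> \<turnstile> \<phi>" by (rule AllI.IH) (use AllI.prems in blast)
  then show ?case by (rule proves.AllI)
next
  case (ImpE \<Gamma> \<phi> \<psi>)
  show ?case by (rule proves.ImpE[OF ImpE.IH]) (rule ImpE.prems)+
next
  case (AllE \<Gamma> \<phi> x)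
  show ?case by (rule proves.AllE[OF AllE.IH]) (rule AllE.prems)
next
  case (EqE \<Gamma> x y \<phi>)
  show ?case by (rule proves.EqE[OF EqE.IH]) (rule EqE.prems)+
qed (auto intro: proves.Assm proves.EqI)

text \<open>The renaming need not be injective. Under a quantifier the lifted renaming commutes with
  the shift \<open>Suc\<close>, so the premise keeps the form that \<open>AllI\<close>
  demands.\<close>

lemma proves_ren: "\<Gamma> \<turnstile> \<phi> \<Longrightarrow> ren \<rho> ` \<Gamma> \<turnstile> ren \<rho> \<phi>"
proof (induction arbitrary: \<rho> rule: proves.induct)
  case (Assm \<phi> \<Gamma>)
  then show ?case by (blast intro: proves.Assm)
next
  case (ImpI \<phi> \<Gamma> \<psi>)
  have "ren \<rho> ` insert \<phi> \<Gamma> \<turnstile> ren \<rho> \<psi>" by (rule ImpI.IH)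
  then show ?case by (simp add: proves.ImpI)
next
  case (ImpE \<Gamma> \<phi> \<psi>)
  have "ren \<rho> ` \<Gamma> \<turnstile> ren \<rho> (\<phi> \<^bold>\<longrightarrow> \<psi>)" "ren \<rho> ` \<Gamma> \<turnstile> ren \<rho> \<phi>" by (rule ImpE.IH)+
  then show ?case unfolding ren.simps by (rule proves.ImpE)
next
  case (Classical \<phi> \<Gamma>)
  have "ren \<rho> ` insert (\<^bold>\<not> \<phi>) \<Gamma> \<turnstile> ren \<rho> Falsum" by (rule Classical.IH)
  then show ?case by (simp add: proves.Classical)
next
  case (AllI \<Gamma> \<phi>)
  let ?\<rho> = "case_nat 0 (Suc \<circ> \<rho>)"
  have "?\<rho> \<circ> Suc = Suc \<circ> \<rho>" by (auto simp: fun_eq_iff)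
  then have "ren ?\<rho> ` ren Suc ` \<Gamma> = ren Suc ` ren \<rho> ` \<Gamma>" by (simp add: image_image ren_ren)
  then show ?case using AllI.IH[of ?\<rho>] by (simp add: proves.AllI)
next
  case (AllE \<Gamma> \<phi> x)
  have "ren \<rho> ` \<Gamma> \<turnstile> All (ren (case_nat 0 (Suc \<circ> \<rho>)) \<phi>)" using AllE.IH by simp
  then show ?case unfolding ren_inst by (rule proves.AllE)
next
  case (EqI \<Gamma> x)
  then show ?case by (simp add: proves.EqI)
next
  case (EqE \<Gamma> x y \<phi>)
  have "ren \<rho> ` \<Gamma> \<turnstile> \<rho> x \<^bold>= \<rho> y" using EqE.IH(1) by simp
  moreover have "ren \<rho> ` \<Gamma> \<turnstile> inst (\<rho> x) (ren (case_nat 0 (Suc \<circ> \<rho>)) \<phi>)"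
    using EqE.IH(2) unfolding ren_inst .
  ultimately show ?case unfolding ren_inst by (rule proves.EqE)
qed

text \<open>Form of \<open>AllI\<close> with a named eigenvariable. The renaming
  \<open>?\<rho>\<close> sends \<open>x\<close> to the bound index and shifts all other variables;
  on the hypotheses, where \<open>x\<close> is not free, it agrees with \<open>Suc\<close>, and on
  \<open>inst x \<phi>\<close> it undoes the instantiation.\<close>

lemma generalization:
  assumes "\<Gamma> \<turnstile> inst x \<phi>" and x: "x \<notin> fv (All \<phi>)" "\<And>\<gamma>. \<gamma> \<in> \<Gamma> \<Longrightarrow> x \<notin> fv \<gamma>"
  shows "\<Gamma> \<turnstile> All \<phi>"
proof -
  let ?\<rho> = "\<lambda>i. if i = x then 0 else Suc i"
  have "ren ?\<rho> \<gamma> = ren Suc \<gamma>" if "\<gamma> \<in> \<Gamma>" for \<gamma>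
    using x(2)[OF that] by (intro ren_cong) auto
  then have "ren ?\<rho> ` \<Gamma> = ren Suc ` \<Gamma>" by simp
  moreover have "ren (?\<rho> \<circ> case_nat x id) \<phi> = ren id \<phi>"
    using x(1) by (intro ren_cong) (auto split: nat.split)
  ultimately show ?thesis
    using proves_ren[OF assms(1), of ?\<rho>] by (simp add: inst_def ren_ren proves.AllI)
qed

lemma ex_falso: "\<Gamma> \<turnstile> Falsum \<Longrightarrow> \<Gamma> \<turnstile> \<phi>"
  by (rule Classical, erule weakening) blast

section \<open>Henkin's construction\<close>

definition fresh :: "'p fm set \<Rightarrow> nat" where
  "fresh \<Gamma> = (SOME x. x \<notin> (\<Union>\<gamma>\<in>\<Gamma>. fv \<gamma>))"

lemma fresh: assumes "finite \<Gamma>" "\<gamma> \<in> \<Gamma>" shows "fresh \<Gamma> \<notin> fv \<gamma>"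
proof -
  have "finite (\<Union>\<gamma>\<in>\<Gamma>. fv \<gamma>)" using assms finite_fv by blast
  then have "\<exists>x. x \<notin> (\<Union>\<gamma>\<in>\<Gamma>. fv \<gamma>)" by (rule ex_new_if_finite[OF infinite_UNIV_nat])
  then have "fresh \<Gamma> \<notin> (\<Union>\<gamma>\<in>\<Gamma>. fv \<gamma>)" unfolding fresh_def by (rule someI_ex)
  then show ?thesis using assms by blast
qed

text \<open>A negated universal that is added gets its counterexample at once: a variable that is
  fresh for all formulas so far. Such a variable exists because every stage is finite, so variables
  take the place of Henkin constants.\<close>

definition henkin_step :: "'p fm set \<Rightarrow> 'p fm \<Rightarrow> 'p fm set" where
  "henkin_step \<Gamma> \<phi> = (if insert \<phi> \<Gamma> \<turnstile> Falsum then \<Gamma>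
     else insert \<phi> \<Gamma> \<union> {\<^bold>\<not> inst (fresh (insert \<phi> \<Gamma>)) \<psi> | \<psi>. \<phi> = (\<^bold>\<not> All \<psi>)})"

lemma henkin_step_finite: assumes "finite \<Gamma>" shows "finite (henkin_step \<Gamma> \<phi>)"
proof -
  have "finite {\<^bold>\<not> inst x \<psi> | \<psi>. \<phi> = (\<^bold>\<not> All \<psi>)}" for x
    by (cases "\<exists>\<psi>. \<phi> = (\<^bold>\<not> All \<psi>)") auto
  then show ?thesis unfolding henkin_step_def using assms by simp
qed

text \<open>If the counterexample were inconsistent with the rest, classical reasoning would prove
  the instance at a fresh variable, and generalization the universal formula that
  \<open>\<phi>\<close> denies.\<close>

lemma henkin_step_consistent:
  assumes fin: "finite \<Gamma>" and con: "\<not> (\<Gamma> \<turnstile> Falsum)"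
  shows "\<not> (henkin_step \<Gamma> \<phi> \<turnstile> Falsum)"
proof
  assume F: "henkin_step \<Gamma> \<phi> \<turnstile> Falsum"
  then have con': "\<not> (insert \<phi> \<Gamma> \<turnstile> Falsum)" using con unfolding henkin_step_def by (auto split: if_splits)
  show False
  proof (cases "\<exists>\<psi>. \<phi> = (\<^bold>\<not> All \<psi>)")
    case False
    then have "henkin_step \<Gamma> \<phi> = insert \<phi> \<Gamma>"
      using con' unfolding henkin_step_def by simp
    then show ?thesis using F con' by simp
  next
    case True
    then obtain \<psi> where \<psi>: "\<phi> = (\<^bold>\<not> All \<psi>)" by blast
    define x where "x = fresh (insert \<phi> \<Gamma>)"
    have x: "x \<notin> fv \<gamma>" if "\<gamma> \<in> insert \<phi> \<Gamma>" for \<gamma>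
      using fresh that fin unfolding x_def by blast
    have "henkin_step \<Gamma> \<phi> = insert (\<^bold>\<not> inst x \<psi>) (insert \<phi> \<Gamma>)"
      using con' \<psi> unfolding henkin_step_def x_def by auto
    with F have "insert (\<^bold>\<not> inst x \<psi>) (insert \<phi> \<Gamma>) \<turnstile> Falsum" by simp
    then have "insert \<phi> \<Gamma> \<turnstile> inst x \<psi>" by (rule Classical)
    moreover have "x \<notin> fv (All \<psi>)" using x[of \<phi>] \<psi> by simp
    ultimately have "insert \<phi> \<Gamma> \<turnstile> All \<psi>" using x by (rule generalization)
    moreover have "insert \<phi> \<Gamma> \<turnstile> \<^bold>\<not> All \<psi>" using \<psi> by (intro Assm) simp
    ultimately have "insert \<phi> \<Gamma> \<turnstile> Falsum" by (rule ImpE[rotated])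
    then show ?thesis using con' by contradiction
  qed
qed

text \<open>The formula \<open>\<phi>\<close> is treated in step \<open>to_nat \<phi>\<close>, so
  the decision about it is visible in stage \<open>Suc (to_nat \<phi>)\<close>.\<close>

primrec henkin_chain :: "'p::countable fm set \<Rightarrow> nat \<Rightarrow> 'p fm set" where
  "henkin_chain \<Gamma> 0 = \<Gamma>"
| "henkin_chain \<Gamma> (Suc n) = henkin_step (henkin_chain \<Gamma> n) (from_nat n)"

lemma henkin_chain_mono: "m \<le> n \<Longrightarrow> henkin_chain \<Gamma> m \<subseteq> henkin_chain \<Gamma> n"
  by (rule lift_Suc_mono_le) (auto simp: henkin_step_def)

lemma henkin_chain_consistent:
  assumes "finite \<Gamma>" "\<not> (\<Gamma> \<turnstile> Falsum)"
  shows "finite (henkin_chain \<Gamma> n) \<and> \<not> (henkin_chain \<Gamma> n \<turnstile> Falsum)"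
  by (induction n) (use assms henkin_step_finite henkin_step_consistent in auto)

text \<open>What the truth lemma needs of a maximal consistent set with witnesses, without mention
  of derivability.\<close>

locale henkin =
  fixes H :: "'p fm set"
  assumes Falsum: "Falsum \<notin> H"
    and Imp: "(\<phi> \<^bold>\<longrightarrow> \<psi>) \<in> H \<longleftrightarrow> (\<phi> \<in> H \<longrightarrow> \<psi> \<in> H)"
    and All: "All \<phi> \<in> H \<longleftrightarrow> (\<forall>x. inst x \<phi> \<in> H)"
    and refl: "(x \<^bold>= x) \<in> H"
    and subst: "(x \<^bold>= y) \<in> H \<Longrightarrow> inst x \<phi> \<in> H \<Longrightarrow> inst y \<phi> \<in> H"

text \<open>A formula derivable from some stage belongs to the union of the chain: its negation
  cannot be derivable from another stage, so it was added in its own step. Closure under the rules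
  follows.\<close>

lemma henkin_extension:
  fixes \<Gamma> :: "'p::countable fm set"
  assumes "finite \<Gamma>" "\<not> (\<Gamma> \<turnstile> Falsum)"
  obtains H where "\<Gamma> \<subseteq> H" "henkin H"
proof
  let ?S = "henkin_chain \<Gamma>"
  let ?H = "\<Union>n. ?S n"
  show "\<Gamma> \<subseteq> ?H" using UN_upper[OF UNIV_I, of ?S 0] unfolding henkin_chain.simps .
  have con: "\<not> (?S n \<turnstile> Falsum)" for n using henkin_chain_consistent[OF assms] by simp
  have cases: "\<phi> \<in> ?H" if "\<not> (?S (to_nat \<phi>) \<turnstile> \<^bold>\<not> \<phi>)" for \<phi>
  proof -
    have "\<not> (insert \<phi> (?S (to_nat \<phi>)) \<turnstile> Falsum)" using that proves.ImpI[of \<phi> "?S (to_nat \<phi>)" Falsum] by blast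
    then have "\<phi> \<in> ?S (Suc (to_nat \<phi>))" by (simp add: henkin_step_def)
    then show ?thesis by blast
  qed
  have ded: "\<phi> \<in> ?H" if "?S n \<turnstile> \<phi>" for n \<phi>
  proof (rule cases, rule)
    assume "?S (to_nat \<phi>) \<turnstile> \<^bold>\<not> \<phi>"
    then have "?S (max n (to_nat \<phi>)) \<turnstile> \<^bold>\<not> \<phi>" by (rule weakening) (simp add: henkin_chain_mono)
    moreover have "?S (max n (to_nat \<phi>)) \<turnstile> \<phi>"
      using that by (rule weakening) (simp add: henkin_chain_mono)
    ultimately show False using con[of "max n (to_nat \<phi>)"] proves.ImpE by metis
  qed
  have two: "\<exists>n. (?S n \<turnstile> \<phi>) \<and> (?S n \<turnstile> \<psi>)" if h: "\<phi> \<in> ?H" "\<psi> \<in> ?H" for \<phi> \<psi>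
  proof -
    obtain m n where "\<phi> \<in> ?S m" "\<psi> \<in> ?S n" using h by blast
    then have "\<phi> \<in> ?S (max m n)" "\<psi> \<in> ?S (max m n)"
      using henkin_chain_mono[of m "max m n" \<Gamma>] henkin_chain_mono[of n "max m n" \<Gamma>] by auto
    then have "?S (max m n) \<turnstile> \<phi>" "?S (max m n) \<turnstile> \<psi>" by (simp_all add: Assm)
    then show ?thesis by blast
  qed
  have Falsum: "Falsum \<notin> ?H" using con proves.Assm[of Falsum] by auto
  have neg: "(\<^bold>\<not> \<phi>) \<in> ?H \<longleftrightarrow> \<phi> \<notin> ?H" for \<phi>
  proof
    assume "(\<^bold>\<not> \<phi>) \<in> ?H"
    then show "\<phi> \<notin> ?H" using two[of "\<^bold>\<not> \<phi>" \<phi>] con ImpE by metis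
  next
    assume "\<phi> \<notin> ?H"
    then have "?S (to_nat \<phi>) \<turnstile> \<^bold>\<not> \<phi>" using cases by blast
    then show "(\<^bold>\<not> \<phi>) \<in> ?H" by (rule ded)
  qed
  show "henkin ?H"
  proof
    show "Falsum \<notin> ?H" by (rule Falsum)
  next
    fix \<phi> \<psi>
    show "(\<phi> \<^bold>\<longrightarrow> \<psi>) \<in> ?H \<longleftrightarrow> (\<phi> \<in> ?H \<longrightarrow> \<psi> \<in> ?H)"
    proof
      assume "(\<phi> \<^bold>\<longrightarrow> \<psi>) \<in> ?H"
      then show "\<phi> \<in> ?H \<longrightarrow> \<psi> \<in> ?H" using two[of "\<phi> \<^bold>\<longrightarrow> \<psi>" \<phi>] ded[OF ImpE] by blast
    next
      assume h: "\<phi> \<in> ?H \<longrightarrow> \<psi> \<in> ?H"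
      show "(\<phi> \<^bold>\<longrightarrow> \<psi>) \<in> ?H"
      proof (cases "\<psi> \<in> ?H")
        case True
        then obtain n where "\<psi> \<in> ?S n" by blast
        then have "insert \<phi> (?S n) \<turnstile> \<psi>" by (intro Assm) simp
        then have "?S n \<turnstile> \<phi> \<^bold>\<longrightarrow> \<psi>" by (rule ImpI)
        then show ?thesis by (rule ded)
      next
        case False
        then have "(\<^bold>\<not> \<phi>) \<in> ?H" using h by (simp only: neg simp_thms)
        then obtain n where "(\<^bold>\<not> \<phi>) \<in> ?S n" by blast
        then have "(\<^bold>\<not> \<phi>) \<in> insert \<phi> (?S n)" by simp
        from proves.ImpE[OF proves.Assm[OF this] proves.Assm] have "insert \<phi> (?S n) \<turnstile> Falsum" by simp
        then have "?S n \<turnstile> \<phi> \<^bold>\<longrightarrow> \<psi>" by (rule proves.ImpI[OF ex_falso])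
        then show ?thesis by (rule ded)
      qed
    qed
  next
    fix \<phi>
    show "All \<phi> \<in> ?H \<longleftrightarrow> (\<forall>x. inst x \<phi> \<in> ?H)"
    proof
      assume "All \<phi> \<in> ?H"
      then obtain n where "?S n \<turnstile> All \<phi>" using two by blast
      then show "\<forall>x. inst x \<phi> \<in> ?H" using ded[OF AllE] by blast
    next
      assume h: "\<forall>x. inst x \<phi> \<in> ?H"
      show "All \<phi> \<in> ?H"
      proof (rule ccontr)
        let ?\<phi> = "\<^bold>\<not> All \<phi>"
        let ?n = "to_nat ?\<phi>"
        assume "All \<phi> \<notin> ?H"
        have "\<not> (insert ?\<phi> (?S ?n) \<turnstile> Falsum)"
        proof
          assume "insert ?\<phi> (?S ?n) \<turnstile> Falsum"
          then have "?S ?n \<turnstile> All \<phi>" by (rule Classical)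
          then have "All \<phi> \<in> ?H" by (rule ded)
          then show False using \<open>All \<phi> \<notin> ?H\<close> by contradiction
        qed
        \<comment> \<open>The negated universal is consistent at its stage, so it entered together
          with a counterexample.\<close>
        then have "(\<^bold>\<not> inst (fresh (insert ?\<phi> (?S ?n))) \<phi>) \<in> ?S (Suc ?n)"
          by (simp add: henkin_step_def)
        then have "(\<^bold>\<not> inst (fresh (insert ?\<phi> (?S ?n))) \<phi>) \<in> ?H" by blast
        then show False using h by (simp only: neg simp_thms)
      qed
    qed
  next
    fix x
    show "(x \<^bold>= x) \<in> ?H" by (rule ded[OF EqI])
  next
    fix x y \<phi>
    show "inst y \<phi> \<in> ?H" if h: "(x \<^bold>= y) \<in> ?H" "inst x \<phi> \<in> ?H"
    proof -
      obtain n where "?S n \<turnstile> x \<^bold>= y" "?S n \<turnstile> inst x \<phi>" using two[OF h] by blast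
      then show ?thesis by (rule ded[OF EqE])
    qed
  qed
qed

section \<open>The Henkin model and the completeness theorem\<close>

context henkin
begin

text \<open>Points are variables up to equality in \<open>H\<close>. The least variable of a class
  represents it, so that the carrier is again a set of numbers.\<close>

definition rep :: "nat \<Rightarrow> nat" where
  "rep x = (LEAST y. (x \<^bold>= y) \<in> H)"

lemma inst_simps [simp]: "inst x Falsum = Falsum" "inst x (i \<^bold>= j) = (case_nat x id i \<^bold>= case_nat x id j)"
  "inst x (Btw P i j k) = Btw P (case_nat x id i) (case_nat x id j) (case_nat x id k)"
  "inst x (Cong i j k l) = Cong (case_nat x id i) (case_nat x id j) (case_nat x id k) (case_nat x id l)"
  by (simp_all add: inst_def)

text \<open>Substitution acts on index 0 only. Here and below \<open>Suc\<close> protects the other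
  variables: the two instances of the given formula are \<open>x = x\<close> and
  \<open>y = x\<close>.\<close>

lemma Eq_sym: "(x \<^bold>= y) \<in> H \<Longrightarrow> (y \<^bold>= x) \<in> H"
  using subst[of x y "0 \<^bold>= Suc x"] refl by simp

lemma Eq_trans: "(x \<^bold>= y) \<in> H \<Longrightarrow> (y \<^bold>= z) \<in> H \<Longrightarrow> (x \<^bold>= z) \<in> H"
  using subst[of y z "Suc x \<^bold>= 0"] by simp

lemma rep_Eq: "(x \<^bold>= rep x) \<in> H"
  unfolding rep_def by (rule LeastI) (rule refl)

lemma rep_iff: "rep x = rep y \<longleftrightarrow> (x \<^bold>= y) \<in> H"
proof
  assume "rep x = rep y"
  then show "(x \<^bold>= y) \<in> H" using rep_Eq Eq_sym Eq_trans by metis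
next
  assume "(x \<^bold>= y) \<in> H"
  then have "(x \<^bold>= z) \<in> H \<longleftrightarrow> (y \<^bold>= z) \<in> H" for z using Eq_sym Eq_trans by metis
  then show "rep x = rep y" by (simp add: rep_def)
qed

lemma Btw_Eq:
  assumes "(x \<^bold>= x') \<in> H" "(y \<^bold>= y') \<in> H" "(z \<^bold>= z') \<in> H" "Btw P x y z \<in> H"
  shows "Btw P x' y' z' \<in> H"
  using subst[OF assms(1), of "Btw P 0 (Suc y) (Suc z)"] subst[OF assms(2), of "Btw P (Suc x') 0 (Suc z)"]
    subst[OF assms(3), of "Btw P (Suc x') (Suc y') 0"] assms(4) by simp

lemma Cong_Eq:
  assumes "(x \<^bold>= x') \<in> H" "(y \<^bold>= y') \<in> H" "(z \<^bold>= z') \<in> H" "(w \<^bold>= w') \<in> H" "Cong x y z w \<in> H"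
  shows "Cong x' y' z' w' \<in> H"
  using subst[OF assms(1), of "Cong 0 (Suc y) (Suc z) (Suc w)"]
    subst[OF assms(2), of "Cong (Suc x') 0 (Suc z) (Suc w)"]
    subst[OF assms(3), of "Cong (Suc x') (Suc y') 0 (Suc w)"]
    subst[OF assms(4), of "Cong (Suc x') (Suc y') (Suc z') 0"] assms(5) by simp

lemma Btw_rep: "Btw P (rep x) (rep y) (rep z) \<in> H \<longleftrightarrow> Btw P x y z \<in> H"
proof
  show "Btw P (rep x) (rep y) (rep z) \<in> H \<Longrightarrow> Btw P x y z \<in> H"
    by (rule Btw_Eq[OF Eq_sym Eq_sym Eq_sym, OF rep_Eq rep_Eq rep_Eq])
  show "Btw P x y z \<in> H \<Longrightarrow> Btw P (rep x) (rep y) (rep z) \<in> H"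
    by (rule Btw_Eq[OF rep_Eq rep_Eq rep_Eq])
qed

lemma Cong_rep: "Cong (rep x) (rep y) (rep z) (rep w) \<in> H \<longleftrightarrow> Cong x y z w \<in> H"
proof
  show "Cong (rep x) (rep y) (rep z) (rep w) \<in> H \<Longrightarrow> Cong x y z w \<in> H"
    by (rule Cong_Eq[OF Eq_sym Eq_sym Eq_sym Eq_sym, OF rep_Eq rep_Eq rep_Eq rep_Eq])
  show "Cong x y z w \<in> H \<Longrightarrow> Cong (rep x) (rep y) (rep z) (rep w) \<in> H"
    by (rule Cong_Eq[OF rep_Eq rep_Eq rep_Eq rep_Eq])
qed

text \<open>The renaming \<open>\<rho>\<close> is there for the induction: a quantifier extends the
  assignment by some \<open>rep x\<close>, and this is absorbed by passing to
  \<open>case_nat x \<rho>\<close>.\<close>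

lemma truth:
  "sat (range rep) (\<lambda>P a b c. Btw P a b c \<in> H) (\<lambda>a b c d. Cong a b c d \<in> H) (rep \<circ> \<rho>) \<phi>
    \<longleftrightarrow> ren \<rho> \<phi> \<in> H"
proof (induction \<phi> arbitrary: \<rho>)
  case (All \<phi>)
  have "case_nat (rep x) (rep \<circ> \<rho>) = rep \<circ> case_nat x \<rho>" for x
    by (auto simp: fun_eq_iff split: nat.split)
  then show ?case
    by (simp only: sat.simps ren.simps ball_simps All.IH henkin.All[OF henkin_axioms] inst_lift)
qed (simp_all add: Falsum Imp rep_iff Btw_rep Cong_rep)

end

text \<open>If \<open>\<phi>\<close> were not derivable, there would be a Henkin model of
  \<open>\<Gamma>\<close> and its negation. By \<open>inf\<close> it is countably infinite and can
  be moved onto \<open>nat\<close>, which is why validity is asked for on that carrier only.\<close>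

theorem completeness:
  fixes \<Gamma> :: "'p::countable fm set"
  assumes fin: "finite \<Gamma>"
    and inf: "\<And>(U :: nat set) R C e. range e \<subseteq> U \<Longrightarrow> \<forall>\<gamma>\<in>\<Gamma>. sat U R C e \<gamma> \<Longrightarrow> infinite U"
    and valid: "\<And>R C (e :: nat \<Rightarrow> nat). \<forall>\<gamma>\<in>\<Gamma>. sat UNIV R C e \<gamma> \<Longrightarrow> sat UNIV R C e \<phi>"
  shows "\<Gamma> \<turnstile> \<phi>"
proof (rule Classical, rule ccontr)
  assume "\<not> (insert (\<^bold>\<not> \<phi>) \<Gamma> \<turnstile> Falsum)"
  then obtain H where H: "insert (\<^bold>\<not> \<phi>) \<Gamma> \<subseteq> H" "henkin H"
    using henkin_extension fin by (metis finite.insertI)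
  interpret henkin H by fact
  define U where "U = range rep"
  define R where "R = (\<lambda>P a b c. Btw P a b c \<in> H)"
  define C where "C = (\<lambda>a b c d. Cong a b c d \<in> H)"
  have t: "sat U R C rep \<psi> \<longleftrightarrow> \<psi> \<in> H" for \<psi>
    using truth[of id \<psi>] by (simp add: U_def R_def C_def)
  have "infinite U" by (rule inf[of rep U R C]) (use H t in \<open>auto simp: U_def\<close>)
  then obtain g where g: "bij_betw g U (UNIV :: nat set)"
    using to_nat_on_infinite[OF countableI_type] by blast
  have iso: "sat UNIV (\<lambda>P a b c. R P (inv_into U g a) (inv_into U g b) (inv_into U g c))
      (\<lambda>a b c d. C (inv_into U g a) (inv_into U g b) (inv_into U g c) (inv_into U g d)) (g \<circ> rep) \<psi>
    \<longleftrightarrow> \<psi> \<in> H" for \<psi>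
    using sat_iso[OF g, of rep R C \<psi>] t by (simp add: U_def)
  have "\<phi> \<in> H" unfolding iso[symmetric] by (rule valid) (use iso H in auto)
  moreover have "\<phi> \<notin> H" using H Imp[of \<phi> Falsum] Falsum by auto
  ultimately show False by blast
qed

section \<open>Tarski planes\<close>

text \<open>\<open>D a b\<close> is the abstract length of a segment: congruence becomes equality of lengths, which
  makes it accessible to equational reasoning.\<close>

locale tarski_plane =
  fixes T :: "'a \<Rightarrow> 'a \<Rightarrow> 'a \<Rightarrow> bool" and D :: "'a \<Rightarrow> 'a \<Rightarrow> 's"
  assumes D_comm: "D a b = D b a"
    and D_zero: "D a b = D c c \<Longrightarrow> a = b"
    and extend: "\<exists>x. T q a x \<and> D a x = D b c"
    and five_seg: "\<lbrakk>a \<noteq> b; T a b c; T a' b' c'; D a b = D a' b'; D b c = D b' c';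
      D a d = D a' d'; D b d = D b' d'\<rbrakk> \<Longrightarrow> D c d = D c' d'"
    and T_same: "T a b a \<Longrightarrow> a = b"
    and pasch: "\<lbrakk>T a p c; T b q c\<rbrakk> \<Longrightarrow> \<exists>x. T p x b \<and> T q x a"
    and lower_dim: "\<exists>a b c. \<not> (T a b c \<or> T b c a \<or> T c a b)"
    and upper_dim: "\<lbrakk>a \<noteq> b; D p a = D p b; D q a = D q b; D r a = D r b\<rbrakk>
      \<Longrightarrow> T p q r \<or> T q r p \<or> T r p q"
    and circumcenter: "\<not> (T a b c \<or> T b c a \<or> T c a b) \<Longrightarrow> \<exists>x. D a x = D b x \<and> D a x = D c x"
begin

section \<open>Betweenness and congruence\<close>

lemma D_null: "D a a = D b b"
  using extend[of b a b b] D_zero by metis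

lemma extend_unique:
  assumes "q \<noteq> a" "T q a x" "T q a y" "D a x = D a y"
  shows "x = y"
  using five_seg[of q a x q a y x x] assms D_zero by metis

lemma sum_segs:
  assumes "T a b c" "T a' b' c'" "D a b = D a' b'" "D b c = D b' c'"
  shows "D a c = D a' c'"
proof (cases "a = b")
  case True
  then show ?thesis using assms D_zero by metis
next
  case False
  then show ?thesis using five_seg[of a b c a' b' c' a a'] assms D_null D_comm by metis
qed

lemma T_right [simp]: "T a b b"
  using extend[of a b b b] D_zero by metis

lemma T_sym: "T a b c \<Longrightarrow> T c b a"
  using pasch[of a b c b c] T_right T_same by metis

lemma T_left [simp]: "T a a b"
  using T_sym T_right by blast

lemma T_antisym: "T a b c \<Longrightarrow> T b a c \<Longrightarrow> a = b"
  using pasch[of a b c b a] T_same by metis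

lemma T_inner: "T a b d \<Longrightarrow> T b c d \<Longrightarrow> T a b c"
  using pasch[of a b d b c] T_same T_sym by metis

lemma T_inner2: "T a b c \<Longrightarrow> T a c d \<Longrightarrow> T b c d"
  using T_inner T_sym by metis

lemma T_outer: assumes "T a b c" "T b c d" "b \<noteq> c" shows "T a c d"
proof -
  obtain x where x: "T a c x" "D c x = D c d" using extend by blast
  then have "T b c x" using assms T_inner2 by blast
  then show ?thesis using extend_unique assms x by metis
qed

lemma T_outer2: assumes "T a b c" "T b c d" "b \<noteq> c" shows "T a b d"
  using T_outer[of d c b a] assms T_sym by metis

lemma T_exch: "T a b d \<Longrightarrow> T b c d \<Longrightarrow> T a c d"
  using T_inner T_outer T_sym by metis

lemma T_exch2: "T a b c \<Longrightarrow> T a c d \<Longrightarrow> T a b d"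
  using T_exch T_sym by metis

lemma other_point: "\<exists>b::'a. a \<noteq> b"
proof -
  obtain p q r where "\<not> T p q r" using lower_dim by blast
  then have "q \<noteq> r" by auto
  then show ?thesis by (cases "a = q") auto
qed

lemma extend_proper: "\<exists>x. T a b x \<and> b \<noteq> x"
  using extend other_point D_zero by metis

text \<open>Prolong \<open>ac\<close> to \<open>e\<close>, compare the distances from
  \<open>e\<close> to \<open>d\<close> by \<open>five_seg\<close>, and come back from
  \<open>e\<close> over \<open>c\<close> to \<open>b\<close>.\<close>

lemma inner_five_seg:
  assumes "T a b c" "T a' b' c'" "D a c = D a' c'" "D b c = D b' c'"
    "D a d = D a' d'" "D c d = D c' d'"
  shows "D b d = D b' d'"
proof (cases "a = c")
  case True
  then show ?thesis using assms D_zero T_same by metis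
next
  case False
  obtain e where e: "T a c e" "c \<noteq> e" using extend_proper by blast
  obtain e' where e': "T a' c' e'" "D c' e' = D c e" using extend by blast
  have "D e d = D e' d'" using five_seg[of a c e a' c' e' d d'] False e e' assms by metis
  moreover have "T e c b" "T e' c' b'" using assms e e' T_inner2 T_sym by blast+
  ultimately show ?thesis
    using five_seg[of e c b e' c' b' d d'] e e' assms D_comm by metis
qed

text \<open>Lay off \<open>ab\<close> and then \<open>bc\<close> from \<open>a'\<close>, on the side
  away from \<open>x\<close>. The total length is \<open>ac\<close>, so by uniqueness the end is
  \<open>c'\<close>.\<close>

lemma transfer_between:
  assumes "T a b c" "D a c = D a' c'"
  shows "\<exists>b'. T a' b' c' \<and> D a b = D a' b' \<and> D b c = D b' c'"
proof (cases "a = c")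
  case True
  then have "a = b" "a' = c'" using assms T_same D_zero by metis+
  then show ?thesis using True D_null T_right by metis
next
  case False
  obtain x where x: "T c' a' x" "a' \<noteq> x" using extend_proper by blast
  obtain b' where b: "T x a' b'" "D a' b' = D a b" using extend by blast
  obtain c2 where c: "T x b' c2" "D b' c2 = D b c" using extend by blast
  have "T a' b' c2" using b c T_inner2 by blast
  then have "D a' c2 = D a c" using sum_segs assms b c by metis
  moreover have "T x a' c2" using b c T_exch2 by blast
  ultimately have "c2 = c'" using extend_unique x assms T_sym by metis
  then show ?thesis using \<open>T a' b' c2\<close> b c by metis
qed

lemma T_cong:
  assumes "T a b c" "D a b = D a' b'" "D b c = D b' c'" "D a c = D a' c'"
  shows "T a' b' c'"
proof -
  obtain x where x: "T a' x c'" "D a b = D a' x" "D b c = D x c'"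
    using transfer_between assms by metis
  have "D x x = D b' x"
    using inner_five_seg[of a' x c' a' x c' x b'] x assms D_comm by metis
  then show ?thesis using x D_zero by metis
qed

section \<open>Collinearity\<close>

definition Col :: "'a \<Rightarrow> 'a \<Rightarrow> 'a \<Rightarrow> bool" where
  "Col a b c \<longleftrightarrow> T a b c \<or> T b c a \<or> T c a b"

lemma Col_perm: "Col a b c \<Longrightarrow> Col b c a" "Col a b c \<Longrightarrow> Col b a c"
  "Col a b c \<Longrightarrow> Col a c b" "Col a b c \<Longrightarrow> Col c a b" "Col a b c \<Longrightarrow> Col c b a"
  unfolding Col_def using T_sym by metis+

lemma Col_triv [simp]: "Col a a b" "Col a b a" "Col a b b"
  unfolding Col_def by auto

lemma Col_equidistant:
  assumes "a \<noteq> b" "Col a b c" "D a p = D a q" "D b p = D b q"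
  shows "D c p = D c q"
proof -
  consider "T a b c" | "T a c b" | "T b a c" using assms T_sym unfolding Col_def by metis
  then show ?thesis
  proof cases
    case 1 then show ?thesis using five_seg[of a b c a b c p q] assms by metis
  next
    case 2 then show ?thesis using inner_five_seg[of a c b a c b p q] assms by metis
  next
    case 3 then show ?thesis using five_seg[of b a c b a c p q] assms by metis
  qed
qed

text \<open>Gupta's theorem. The segments are prolonged crosswise by the length \<open>cd\<close>,
  from \<open>d\<close> to \<open>c'\<close> and from \<open>c\<close> to \<open>d'\<close>; it is
  then enough that \<open>c = c'\<close> or \<open>d = d'\<close>.\<close>

lemma connectivity:
  assumes ab: "a \<noteq> b" and abc: "T a b c" and abd: "T a b d"
  shows "T a c d \<or> T a d c"
proof (cases "b = c \<or> b = d \<or> c = d")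
  case True
  then show ?thesis using assms by auto
next
  case False
  then have ne: "b \<noteq> c" "b \<noteq> d" "c \<noteq> d" by auto
  obtain c' where c': "T a d c'" "D d c' = D c d" using extend by blast
  obtain d' where d': "T a c d'" "D c d' = D c d" using extend by blast
  obtain b' where b': "T a c' b'" "D c' b' = D c b" using extend by blast
  obtain b2 where b2: "T a d' b2" "D d' b2 = D d b" using extend by blast
  have bdc': "T b d c'" and bcd': "T b c d'" using T_inner2 abc abd c' d' by blast+
  have abc': "T a b c'" and abd': "T a b d'" using T_exch2 abc abd c' d' by blast+
  have bc'b': "T b c' b'" and bd'b2: "T b d' b2" using T_inner2 abc' abd' b' b2 by blast+
  have dc'b': "T d c' b'" and cd'b2: "T c d' b2" using T_inner2 c' d' b' b2 by blast+
  have "D b c' = D b2 c"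
    using sum_segs[of b d c' b2 d' c] bdc' T_sym[OF cd'b2] c' d' b2 D_comm by metis
  then have "D b b' = D b2 b"
    using sum_segs[of b c' b' b2 c b] bc'b' b' T_sym[OF T_exch2[OF bcd' bd'b2]] by blast
  moreover have "T a b b'" "T a b b2" using T_exch2 abc' abd' b' b2 by blast+
  \<comment> \<open>Both points lie beyond \<open>b\<close> at the same distance.\<close>
  ultimately have bb: "b2 = b'" using extend_unique ab D_comm by metis
  have bb2: "D b c' = D b' c" using \<open>D b c' = D b2 c\<close> bb by simp
  have "D d' c' = D d c"
    using five_seg[of b c d' b' c' d c' c] ne(1) bcd' T_sym[OF dc'b'] b' c' d' bb2 D_comm by metis
  have "T c d' b'" using cd'b2 bb by simp
  \<comment> \<open>\<open>e\<close> is the crossing of the segments \<open>dd'\<close> and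
    \<open>cc'\<close>; it turns out to halve both.\<close>
  then obtain e where e: "T d' e d" "T c' e c"
    using pasch[of c d' b' d c'] dc'b' by blast
  have ec: "D e c = D e c'"
    using inner_five_seg[of d e d' d e d' c c'] e T_sym c' d' \<open>D d' c' = D d c\<close> D_comm by metis
  have ed: "D e d = D e d'"
    using inner_five_seg[of c e c' c e c' d d'] e T_sym c' d' \<open>D d' c' = D d c\<close> D_comm by metis
  show ?thesis
  proof (cases "c = c'")
    case True
    then show ?thesis using c' by simp
  next
    case False
    have cd'n: "c \<noteq> d'" using d' ne D_zero by metis
    \<comment> \<open>The points \<open>p\<close>, \<open>r\<close>, \<open>q\<close> form a copy of
      \<open>d'\<close>, \<open>e\<close>, \<open>d\<close>. Starting from \<open>c\<close> and
      \<open>r\<close>, equidistance from \<open>p\<close> and \<open>q\<close> spreads along lines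
      to \<open>d'\<close>, \<open>b\<close>, \<open>b'\<close>, \<open>c'\<close> and at last to
      \<open>p\<close> itself. So the copy collapses, and \<open>d = d'\<close>.\<close>
    obtain p where p: "T c' c p" "D c p = D c d'" using extend by blast
    obtain r where r: "T d' c r" "D c r = D c e" using extend by blast
    obtain q where q: "T p r q" "D r q = D r p" using extend by blast
    have "T e c p" using e p T_inner2 by blast
    then have rp: "D r p = D e d'"
      using five_seg[of d' c r p c e p d'] cd'n r p D_comm T_sym by metis
    have dr: "D r q = D e d" using rp ed q by simp
    have rpe: "D p r = D d' e" using rp D_comm by metis
    have "D d' d = D p q"
      using sum_segs[of d' e d p r q] e q rpe dr by metis
    have "D d c = D q c"
    proof (cases "d' = e")
      case True
      then have "d = e" using ed D_zero by metis
      moreover have "p = r" using rpe True D_zero by metis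
      then have "p = q" using q D_zero by metis
      ultimately show ?thesis using True p D_comm by metis
    next
      case False
      then show ?thesis
        using five_seg[of d' e d p r q c c] e q rpe dr p r D_comm by metis
    qed
    then have cpq: "D c p = D c q" using d' p D_comm by metis
    have rc: "r \<noteq> c"
    proof
      assume "r = c"
      then have "e = c" using r D_zero by metis
      then show False using ec \<open>c \<noteq> c'\<close> D_zero by metis
    qed
    have d'pq: "D d' p = D d' q"
      using Col_equidistant[of r c d' p q] rc r q cpq T_sym unfolding Col_def by metis
    have bpq: "D b p = D b q"
      using Col_equidistant[of c d' b p q] cd'n bcd' cpq d'pq unfolding Col_def by metis
    have b'pq: "D b' p = D b' q"
      using Col_equidistant[of c d' b' p q] cd'n \<open>T c d' b'\<close> cpq d'pq unfolding Col_def by metis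
    have "b \<noteq> b'" using bc'b' bdc' ne T_same by metis
    then have "D c' p = D c' q"
      using Col_equidistant[of b b' c' p q] bc'b' bpq b'pq T_sym unfolding Col_def by metis
    then have "D p p = D p q"
      using Col_equidistant[of c' c p p q] False p cpq unfolding Col_def by metis
    then have "p = q" using D_zero by metis
    then have "p = r" using q T_same by metis
    then have "d' = e" using rpe D_zero by metis
    then have "d = d'" using ed D_zero by metis
    then show ?thesis using d' by simp
  qed
qed

lemma connectivity2: "\<lbrakk>a \<noteq> b; T a b c; T a b d\<rbrakk> \<Longrightarrow> T b c d \<or> T b d c"
  using connectivity T_inner2 by metis

text \<open>Prolonging the segment beyond \<open>a\<close> reduces this to
  \<open>connectivity2\<close>.\<close>

lemma connectivity3: assumes "T a b d" "T a c d" shows "T a b c \<or> T a c b"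
proof -
  obtain x where x: "T d a x" "a \<noteq> x" using extend_proper by blast
  then have "T x a b" "T x a c" using assms T_inner2 T_sym by metis+
  then show ?thesis using connectivity2 x by metis
qed

lemma ray_unique:
  assumes "T r a b \<or> T r b a" "D r a = D r b" shows "a = b"
proof -
  have *: "a = b" if "T r a b" "D r a = D r b" for a b
  proof -
    obtain x where x: "T b r x" "r \<noteq> x" using extend_proper by blast
    then have "T x r b" using T_sym by blast
    then have "T x r a" using T_inner that by blast
    then show ?thesis using extend_unique[of x r a b] x \<open>T x r b\<close> that by blast
  qed
  show ?thesis using assms *[of a b] *[of b a] by auto
qed

text \<open>Up to exchange of \<open>a\<close> and \<open>b\<close>, the cases are sorted by their
  positions relative to \<open>pq\<close>. Connectivity orders points on the same side, transitivity
  does the rest.\<close>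

lemma Col_trans:
  assumes "p \<noteq> q" "Col p q a" "Col p q b"
  shows "Col p a b"
proof -
  have *: "Col p a b" if "T p q a \<or> T p a q \<or> T q p a" "T p q b" for a b
    using that(1)
  proof (elim disjE)
    assume "T p q a"
    then show ?thesis using connectivity[of p q a b] that assms(1) T_sym unfolding Col_def by metis
  next
    assume "T p a q"
    then show ?thesis using T_exch2 that(2) unfolding Col_def by metis
  next
    assume "T q p a"
    then have "T a p b" using T_outer2[of a p q b] that assms(1) T_sym by metis
    then show ?thesis using T_sym unfolding Col_def by metis
  qed
  have **: "Col p a b" if "T p a q \<or> T q p a" "T p b q" for a b
    using that(1)
  proof
    assume "T p a q"
    then show ?thesis using connectivity3 that(2) T_sym unfolding Col_def by metis
  next
    assume "T q p a"
    then have "T a p b" using T_inner[of a p q b] that T_sym by metis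
    then show ?thesis using T_sym unfolding Col_def by metis
  qed
  have ***: "Col p a b" if "T q p a" "T q p b" for a b
    using connectivity2[of q p a b] that assms(1) T_sym unfolding Col_def by metis
  have "T p q a \<or> T p a q \<or> T q p a" "T p q b \<or> T p b q \<or> T q p b"
    using assms T_sym unfolding Col_def by metis+
  then show ?thesis using *[of a b] *[of b a] **[of a b] **[of b a] ***[of a b] Col_perm by metis
qed

lemma Col_trans3:
  assumes "p \<noteq> q" "Col p q a" "Col p q b" "Col p q c"
  shows "Col a b c"
  using assms Col_trans Col_perm by metis

lemma Col_line:
  assumes "Col u v x" "Col u v y" "Col x y z" "u \<noteq> v" "x \<noteq> y"
  shows "Col u v z"
proof -
  have "Col x y u" "Col x y v"
    using Col_trans3[of u v x y] assms by simp_all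
  then show ?thesis using Col_trans3[of x y u v z] assms by simp
qed

lemma Col_T:
  assumes "Col u v x" "Col u v y" "T x z y" "u \<noteq> v"
  shows "Col u v z"
proof (cases "x = y")
  case True
  then show ?thesis using assms T_same by blast
next
  case False
  have "Col x y z" using assms T_sym unfolding Col_def by blast
  then show ?thesis using Col_line assms False by blast
qed

section \<open>Point reflections and midpoints\<close>

definition mid :: "'a \<Rightarrow> 'a \<Rightarrow> 'a \<Rightarrow> bool" where
  "mid a m b \<longleftrightarrow> T a m b \<and> D m a = D m b"

definition S :: "'a \<Rightarrow> 'a \<Rightarrow> 'a" where
  "S m a = (SOME x. mid a m x)"

lemma mid_S: "mid a m (S m a)"
proof -
  have "\<exists>x. mid a m x" using extend[of a m m a] unfolding mid_def by metis
  then show ?thesis unfolding S_def by (rule someI_ex)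
qed

lemma mid_sym: "mid a m b \<Longrightarrow> mid b m a"
  unfolding mid_def using T_sym by metis

lemma mid_unique: "mid a m b \<Longrightarrow> mid a m b' \<Longrightarrow> b = b'"
  unfolding mid_def using extend_unique D_zero by metis

lemma S_eqI: "mid a m b \<Longrightarrow> S m a = b"
  using mid_S mid_unique by blast

lemma S_S [simp]: "S m (S m a) = a"
  using S_eqI mid_S mid_sym by blast

lemma S_center [simp]: "S m m = m"
  by (rule S_eqI) (simp add: mid_def)

lemma S_T: "T a m (S m a)" "T (S m a) m a"
  using mid_S[of a m] T_sym by (auto simp: mid_def)

lemma S_D: "D m (S m a) = D m a"
  using mid_S[of a m] by (simp add: mid_def)

lemma S_fixed: "S m a = a \<Longrightarrow> a = m"
  using S_T T_same by metis

lemma S_Col: "Col m a (S m a)" "Col a m (S m a)" "Col a (S m a) m"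
  using S_T[where m=m and a=a] unfolding Col_def by auto

text \<open>Prolonging \<open>ma\<close> by the length \<open>bm\<close> and \<open>mb\<close> by
  the length \<open>am\<close>, likewise on the mirrored side, puts \<open>x\<close>,
  \<open>y\<close>, \<open>x'\<close>, \<open>y'\<close> at one distance from \<open>m\<close>. The
  five-segment axiom compares these outer points, and its inner form carries the congruence in,
  first to \<open>b\<close> and then to \<open>a\<close>.\<close>

lemma S_iso: "D (S m a) (S m b) = D a b"
proof (cases "a = m")
  case True
  then show ?thesis using S_D by simp
next
  case False
  obtain x where x: "T (S m a) a x" "D a x = D b m" using extend by blast
  obtain y where y: "T (S m b) b y" "D b y = D a m" using extend by blast
  obtain x' where x': "T x (S m a) x'" "D (S m a) x' = D b m" using extend by blast
  obtain y' where y': "T y (S m b) y'" "D (S m b) y' = D a m" using extend by blast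
  have tx: "T x a m" "T x m (S m a)" using x S_T T_inner T_exch T_sym by metis+
  have ty: "T y b m" "T y m (S m b)" using y S_T T_inner T_exch T_sym by metis+
  have tx': "T m (S m a) x'" "T x m x'" using tx x' T_inner2 T_exch2 by metis+
  have ty': "T m (S m b) y'" "T y m y'" using ty y' T_inner2 T_exch2 by metis+
  have dm: "D m (S m a) = D m a" "D m (S m b) = D m b" using S_D by auto
  have xy: "D m x = D y m"
    using sum_segs[of m a x y b m] tx ty x y T_sym D_comm by metis
  have x'y: "D m x' = D y m"
    using sum_segs[of m "S m a" x' y b m] tx' ty x' y dm D_comm by metis
  have xy': "D m x = D y' m"
    using sum_segs[of m a x y' "S m b" m] tx ty' x y' dm T_sym D_comm by metis
  have "x \<noteq> m" using tx False T_same by metis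
  then have e: "D x' y' = D y x"
    using five_seg[of x m x' y' m y y' x] tx' ty' xy x'y xy' T_sym D_comm by metis
  then have "D b x = D (S m b) x'"
    using inner_five_seg[of y b m y' "S m b" m x x'] ty ty' T_sym xy x'y xy' dm D_comm by metis
  then show ?thesis
    using inner_five_seg[of x a m x' "S m a" m b "S m b"] tx tx' T_sym xy x'y xy' dm D_comm by metis
qed

lemma S_T_iff: "T (S m a) (S m b) (S m c) \<longleftrightarrow> T a b c"
  using T_cong[of a b c "S m a" "S m b" "S m c"] T_cong[of "S m a" "S m b" "S m c" a b c] S_iso
  by metis

lemma S_Col_iff: "Col (S m a) (S m b) (S m c) \<longleftrightarrow> Col a b c"
  unfolding Col_def S_T_iff ..

lemma S_inj: "S m a = S m b \<Longrightarrow> a = b"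
  using S_S by metis

text \<open>Prolong the legs equally to \<open>p\<close> and \<open>q\<close>. The cross segments
  \<open>aq\<close> and \<open>bp\<close> meet in a point \<open>r\<close> on the axis of symmetry,
  and the line \<open>rc\<close> meets the base in its midpoint.\<close>

lemma isosceles_mid:
  assumes "D c a = D c b" shows "\<exists>m. mid a m b"
proof (cases "Col c a b")
  case True
  then consider "T a c b" | "T c a b \<or> T c b a" unfolding Col_def using T_sym by metis
  then show ?thesis
  proof cases
    case 1 then show ?thesis using assms unfolding mid_def by auto
  next
    case 2 then have "a = b" using ray_unique assms by blast
    then show ?thesis unfolding mid_def using T_right by metis
  qed
next
  case False
  then have ne: "c \<noteq> a" "c \<noteq> b" "a \<noteq> b" by auto
  obtain p where p: "T c a p" "a \<noteq> p" using extend_proper by blast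
  obtain q where q: "T c b q" "D b q = D a p" using extend by blast
  obtain r where r: "T a r q" "T b r p"
    using pasch[of p a c q b] p q T_sym by blast
  obtain x where x: "T a x b" "T r x c"
    using pasch[of c a p b r] p r by blast
  have aq: "D a q = D b p"
    using five_seg[of c a p c b q b a] ne p q assms D_comm by metis
  \<comment> \<open>\<open>r'\<close> is the mirror image of \<open>r\<close> on \<open>aq\<close>.
    It lies on \<open>bp\<close> as well and so equals \<open>r\<close>, which makes
    \<open>r\<close> equidistant from \<open>a\<close> and \<open>b\<close>.\<close>
  obtain r' where r': "T a r' q" "D b r = D a r'" "D r p = D r' q"
    using transfer_between[of b r p a q] r aq by metis
  have i1: "D r a = D r' b"
    using inner_five_seg[of b r p a r' q a b] r r' aq q D_comm[of b a] D_comm[of p a] D_comm[of q b] by simp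
  have i2: "D r q = D r' p"
    using inner_five_seg[of b r p a r' q q p] r r' aq q D_comm[of p q] by simp
  have "T b r' p"
    using T_cong[of a r q b r' p] r i1 i2 aq D_comm[of a r] D_comm[of r' b] by simp
  have "r = r'"
  proof (rule ccontr)
    assume n: "r \<noteq> r'"
    have "Col a q r" "Col a q r'" "Col b p r" "Col b p r'"
      using r r' \<open>T b r' p\<close> T_sym unfolding Col_def by blast+
    moreover have "a \<noteq> q" "b \<noteq> p" using p q False T_sym unfolding Col_def by blast+
    ultimately have "Col r r' a" "Col r r' q" "Col r r' b" "Col r r' p"
      using Col_trans3[of a q r r'] Col_trans3[of b p r r'] by simp_all
    then have "Col a p b" using Col_trans3 n by blast
    moreover have "Col a p c" using p T_sym unfolding Col_def by blast
    ultimately have "Col a b c" using p Col_trans by blast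
    then show False using False Col_perm by blast
  qed
  then have ra: "D r a = D r b" using i1 by simp
  have "r \<noteq> c"
  proof
    assume "r = c"
    then have "T a c q" using r by simp
    then have "Col c q a" "Col c q b" using q T_sym unfolding Col_def by blast+
    moreover have "c \<noteq> q" using q ne T_same by metis
    ultimately show False using False Col_trans by metis
  qed
  moreover have "Col r c x" using x T_sym unfolding Col_def by blast
  ultimately have "D x a = D x b" using Col_equidistant ra assms by blast
  then show ?thesis using x unfolding mid_def by metis
qed

section \<open>Right angles, chords and perpendiculars\<close>

definition Per :: "'a \<Rightarrow> 'a \<Rightarrow> 'a \<Rightarrow> bool" where
  "Per a b c \<longleftrightarrow> D a c = D a (S b c)"

lemma Per_sym: "Per a b c \<Longrightarrow> Per c b a"
  unfolding Per_def using S_iso[of b a "S b c"] D_comm by simp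

lemma Per_Col: "\<lbrakk>Per a b c; a \<noteq> b; Col b a a'\<rbrakk> \<Longrightarrow> Per a' b c"
  using Col_equidistant[of a b a' c "S b c"] S_D[of b c] Col_perm(2)[of b a a']
  by (simp add: Per_def)

text \<open>Each of \<open>a\<close> and \<open>S c a\<close> is equidistant from \<open>c\<close>
  and \<open>S b c\<close>. Then so is \<open>c\<close>, which lies on their line, and hence
  \<open>S b c = c\<close>.\<close>

lemma Per_unique: assumes "Per a b c" "Per a c b" shows "b = c"
proof (rule ccontr)
  assume n: "b \<noteq> c"
  have "Per b c a" using assms Per_sym by blast
  then have "Per (S b c) c a" using Per_Col[of b c a "S b c"] n S_Col Col_perm by metis
  then have "D (S b c) a = D (S b c) (S c a)" by (simp add: Per_def)
  moreover have "D a c = D a (S b c)" using assms by (simp add: Per_def)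
  moreover have "D (S c a) c = D a c" using S_D D_comm by metis
  ultimately have "D (S c a) c = D (S c a) (S b c)" "D a c = D a (S b c)" using D_comm by metis+
  moreover have "a \<noteq> S c a \<or> a = c" using S_fixed by metis
  ultimately have "D c c = D c (S b c)"
    using Col_equidistant[of a "S c a" c c "S b c"] S_Col by metis
  then have "S b c = c" using D_zero by metis
  then show False using S_fixed n by metis
qed

lemma Per_cong:
  assumes "Per a b c" "D a b = D a' b'" "D b c = D b' c'" "D a c = D a' c'"
  shows "Per a' b' c'"
proof (cases "b = c")
  case True
  then show ?thesis using assms D_zero unfolding Per_def by (metis S_center)
next
  case False
  have "D (S b c) a = D (S b' c') a'"
    using five_seg[of c b "S b c" c' b' "S b' c'" a a'] False assms S_T S_D D_comm by metis
  then show ?thesis using assms D_comm unfolding Per_def by metis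
qed

lemma S_Per_iff: "Per (S m a) (S m b) (S m c) \<longleftrightarrow> Per a b c"
  using Per_cong[of a b c "S m a" "S m b" "S m c"] Per_cong[of "S m a" "S m b" "S m c" a b c]
  by (auto simp: S_iso)

text \<open>The midpoints of the chords \<open>xy\<close> and \<open>xz\<close> are both feet of the
  perpendicular from \<open>a\<close>. They agree by \<open>Per_unique\<close>, and with them
  \<open>y\<close> and \<open>z\<close>.\<close>

lemma circle_line_two:
  assumes "Col x y z" "D a x = D a y" "D a x = D a z"
  shows "x = y \<or> x = z \<or> y = z"
proof (rule ccontr)
  assume n: "\<not> ?thesis"
  obtain m where m: "mid x m y" using isosceles_mid assms by blast
  obtain k where k: "mid x k z" using isosceles_mid assms by blast
  have s: "S m x = y" "S k x = z" using m k S_eqI by auto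
  have "Per x m a" "Per x k a" using assms s Per_sym unfolding Per_def by metis+
  moreover have "x \<noteq> m" "x \<noteq> k" using s n by auto
  moreover have "Col x m k"
    using m k n assms(1) Col_T[of x y x y m] Col_T[of x y x z k] Col_trans[of x y m k]
    by (simp add: mid_def)
  ultimately have "Per k m a" "Per m k a" using Per_Col Col_perm by metis+
  then have "m = k" using Per_unique Per_sym by metis
  then show False using s n by auto
qed

text \<open>A crossing at an end of \<open>pb\<close> or \<open>qa\<close> would force a
  collinearity that spreads to \<open>a\<close>, \<open>b\<close>, \<open>c\<close>.\<close>

lemma pasch_strict:
  assumes nc: "\<not> Col a b c" and p: "T a p c" "a \<noteq> p" "p \<noteq> c" and q: "T b q c" "b \<noteq> q" "q \<noteq> c"
  shows "\<exists>x. T p x b \<and> p \<noteq> x \<and> x \<noteq> b \<and> T q x a \<and> q \<noteq> x \<and> x \<noteq> a"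
proof -
  obtain x where x: "T p x b" "T q x a" using pasch p q by blast
  have l: "Col a p c" "Col b q c" using p q unfolding Col_def by blast+
  have 1: "\<not> Col a p q"
  proof
    assume "Col a p q"
    then have "Col a c q" using Col_trans[of a p c q] l p by blast
    then have "Col q c a" "Col q c b" using l Col_perm by blast+
    then have "Col q a b" "Col q c a" "Col q c b" using Col_trans q by blast+
    then have "Col c a b" using Col_trans[of c q a b] q Col_perm by blast
    then show False using nc Col_perm by blast
  qed
  have 2: "\<not> Col b q p"
  proof
    assume "Col b q p"
    then have "Col b c p" using Col_trans[of b q c p] l q by blast
    then have "Col c p b" "Col c p a" using l Col_perm by blast+
    then have "Col c b a" using Col_trans[of c p b a] p by blast
    then show False using nc Col_perm by blast
  qed
  have 3: "\<not> Col b q a"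
  proof
    assume "Col b q a"
    then have "Col b c a" using Col_trans[of b q c a] l q by blast
    then show False using nc Col_perm by blast
  qed
  have 4: "\<not> Col a p b"
  proof
    assume "Col a p b"
    then have "Col a c b" using Col_trans[of a p c b] l p by blast
    then show False using nc Col_perm by blast
  qed
  have "p \<noteq> x" using x 1 Col_perm unfolding Col_def by blast
  moreover have "x \<noteq> b" using x 3 T_sym unfolding Col_def by blast
  moreover have "q \<noteq> x" using x 2 T_sym unfolding Col_def by blast
  moreover have "x \<noteq> a" using x 4 T_sym unfolding Col_def by blast
  ultimately show ?thesis using x by blast
qed

text \<open>Add a point off the line \<open>ab\<close>; the circumcenter of the triangle is the apex
  of an isosceles triangle over \<open>ab\<close>.\<close>

lemma ex_mid: "\<exists>m. mid a m b"
proof (cases "a = b")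
  case True
  then show ?thesis unfolding mid_def using T_right by metis
next
  case False
  have "\<exists>c. \<not> Col a b c"
  proof (rule ccontr)
    assume "\<nexists>c. \<not> Col a b c"
    then have "Col x y z" for x y z using Col_trans3 False by blast
    then show False using lower_dim unfolding Col_def by blast
  qed
  then show ?thesis using circumcenter isosceles_mid D_comm unfolding Col_def by metis
qed

text \<open>Gupta's construction of the foot of a perpendicular; collinearity of \<open>y\<close>, \<open>z\<close> and the
  foot follows from the upper dimension axiom.\<close>

lemma foot:
  assumes abc: "\<not> Col a b c"
  shows "\<exists>x. Col a b x \<and> D a (S x c) = D a c \<and> D b (S x c) = D b c"
proof -
  have ne: "a \<noteq> b" "a \<noteq> c" using abc by auto
  obtain y where y: "T b a y" "D a y = D a c" using extend by blast
  have ay: "a \<noteq> y" using y ne D_zero by metis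
  have bay: "Col a b y" using y T_sym unfolding Col_def by blast
  have cy: "c \<noteq> y" using bay abc by blast
  obtain p where p: "mid c p y" using isosceles_mid y by metis
  have py: "p \<noteq> y" using p cy D_zero unfolding mid_def by metis
  obtain z where z: "T a y z" "D y z = D y p" using extend by blast
  obtain q where q: "T p y q" "D y q = D y a" using extend by blast
  define q' where "q' = S z q"
  obtain c' where c': "T q' y c'" "D y c' = D y c" using extend by blast
  have Sp: "S p y = c" using p S_eqI mid_sym by blast
  have zq: "D z q = D p a"
    using five_seg[of a y z q y p q a] ay z q T_sym[OF q(1)] D_comm[of a y] D_comm[of q y] D_comm[of a q]
    by simp
  \<comment> \<open>\<open>a\<close> is equidistant from \<open>y\<close> and its mirror image
    \<open>c\<close>, so the angle at \<open>p\<close> is right; congruence moves it to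
    \<open>z\<close>.\<close>
  have "Per a p y" using y Sp unfolding Per_def by simp
  then have "Per q z y"
    using Per_cong[of a p y q z y] zq z q D_comm by metis
  then have yq: "D y q = D y q'" using Per_sym unfolding Per_def q'_def by blast
  have tqyc: "T q y c"
    using T_outer2[of q y p c] T_sym[OF q(1)] p py T_sym unfolding mid_def by metis
  have yc: "D y c = D y c'" using c' by simp
  then obtain x where x: "mid c x c'" using isosceles_mid by blast
  have zqq: "D z q = D z q'" unfolding q'_def using S_D by simp
  have xqq: "D x q = D x q'"
    using five_seg[of c y q c' y q' x x] x T_sym[OF tqyc] T_sym[OF c'(1)] cy yc yq
      D_comm[of c y] D_comm[of c' y] D_comm[of c x] D_comm[of c' x] D_comm[of q x] D_comm[of q' x]
    unfolding mid_def by simp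
  have yz: "y \<noteq> z" using z py D_zero by metis
  have "q \<noteq> q'"
  proof
    assume "q = q'"
    then have "q = z" using S_fixed unfolding q'_def by metis
    then have "p = a" using zq D_zero by metis
    then have "Col a y c" using p T_sym unfolding mid_def Col_def by blast
    then show False using abc Col_trans[of a y b c] ay bay Col_perm by blast
  qed
  then have "Col y z x"
    using upper_dim[of q q' y z x] yq zqq xqq unfolding Col_def by blast
  moreover have ayz: "Col a y z" using z unfolding Col_def by blast
  then have yza: "Col y z a" using Col_perm by blast
  have yzb: "Col y z b" using Col_trans[of y a z b] ay ayz bay Col_perm by blast
  ultimately have abx: "Col a b x" using Col_trans3[of y z a b x] yz yza by blast
  have "q \<noteq> y" using q ay D_zero by metis
  then have zc: "D z c = D z c'"
    using five_seg[of q y c q' y c' z z] tqyc c' yq zqq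
      D_comm[of q y] D_comm[of q' y] D_comm[of q z] D_comm[of q' z] D_comm[of c z] D_comm[of c' z]
    by simp
  have "D a c = D a c'" "D b c = D b c'"
    using Col_equidistant[of y z] yz yza yzb yc zc by blast+
  moreover have "S x c = c'" using x S_eqI by blast
  ultimately show ?thesis using abx by metis
qed

lemma S_eq_center: "S m a = m \<Longrightarrow> a = m"
  using S_S[of m a] by simp

lemma D_foot:
  assumes "u \<noteq> v" "D u (S x c) = D u c" "D v (S x c) = D v c" "Col u v e"
  shows "D e (S x c) = D e c"
  using Col_equidistant[of u v e "S x c" c] assms by blast

section \<open>Plane separation\<close>

definition opp :: "'a \<Rightarrow> 'a \<Rightarrow> 'a \<Rightarrow> 'a \<Rightarrow> bool" where
  "opp u v a c \<longleftrightarrow> \<not> Col u v a \<and> \<not> Col u v c \<and> (\<exists>t. Col u v t \<and> T a t c)"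

lemma opp_sym: "opp u v a c \<Longrightarrow> opp u v c a"
  unfolding opp_def using T_sym by blast

text \<open>Inner Pasch in the triangle \<open>r\<close>, \<open>a\<close>, \<open>c\<close>: the
  segment \<open>bc\<close> is crossed between \<open>t\<close> and \<open>r\<close>, hence on the
  line.\<close>

lemma in_move:
  assumes uv: "u \<noteq> v" and o: "opp u v a c" and r: "Col u v r" "T r b a" "b \<noteq> r"
  shows "opp u v b c"
proof -
  obtain t where t: "Col u v t" "T a t c" using o unfolding opp_def by blast
  obtain x where x: "T b x c" "T t x r" using pasch[of r b a c t] r T_sym[OF t(2)] by blast
  have "\<not> Col u v b"
  proof
    assume "Col u v b"
    moreover have "Col r b a" using r unfolding Col_def by blast
    ultimately have "Col u v a" using Col_line uv r by blast
    then show False using o unfolding opp_def by blast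
  qed
  moreover have "Col u v x" using Col_T[OF t(1) r(1) x(2) uv] .
  ultimately show ?thesis using x o unfolding opp_def by blast
qed

lemma out_move:
  assumes uv: "u \<noteq> v" and nc: "\<not> Col u v a" and m: "Col u v m" "S m a = c"
    and r: "Col u v r" "T r a b" "a \<noteq> r"
  shows "opp u v b c"
proof -
  have nb: "\<not> Col u v b" using Col_T[OF r(1) _ r(2) uv] nc by blast
  have c: "\<not> Col u v c"
  proof
    assume c: "Col u v c"
    have "Col m c a" using S_Col(1)[of m a] m(2) Col_perm(3) by blast
    moreover have "m \<noteq> c" using S_eq_center m nc by blast
    ultimately
    show False using Col_line[OF m(1) c] uv nc by blast
  qed
  have T: "T (S m r) c (S m b)" using r(2) S_T_iff[of m r a b] m(2) by simp
  obtain x where x: "T m x (S m r)" "T c x b"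
    using pasch[of b m "S m b" "S m r" c] S_T T by blast
  have "Col u v (S m r)"
  proof (cases "m = r")
    case True then show ?thesis using r by simp
  next
    case False then show ?thesis using Col_line[OF m(1) r(1) S_Col(1)] uv by blast
  qed
  then have "Col u v x" using Col_T[OF m(1) _ x(1) uv] by blast
  then show ?thesis using nb c T_sym[OF x(2)] unfolding opp_def by blast
qed

text \<open>The lines \<open>ac\<close> and \<open>ac'\<close> share, besides \<open>a\<close>, the
  mirror image \<open>b\<close> of the crossing \<open>w\<close>. So they are one line, which meets
  \<open>uv\<close> only in \<open>s\<close>; then \<open>c\<close> and \<open>c'\<close> lie on one
  ray from \<open>s\<close> at equal distance.\<close>

lemma opp_both_mirror_False:
  assumes uv: "u \<noteq> v" and s: "Col u v s" and c': "c' = S s c" "D u c' = D u c" "D v c' = D v c"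
    and o: "opp u v a c" "opp u v a c'"
  shows False
proof -
  have eq: "D e c' = D e c" if "Col u v e" for e
    using D_foot uv c' that by blast
  have nc: "\<not> Col u v a" "\<not> Col u v c" "\<not> Col u v c'" using o unfolding opp_def by auto
  obtain t where t: "Col u v t" "T a t c" using o unfolding opp_def by blast
  obtain t' where t': "Col u v t'" "T a t' c'" using o unfolding opp_def by blast
  obtain w where w: "T t w c'" "T t' w c"
    using pasch[of c t a c' t'] T_sym[OF t(2)] T_sym[OF t'(2)] by blast
  \<comment> \<open>\<open>b\<close> is the mirror image of \<open>w\<close>: it lies on
    \<open>tc\<close> by choice and on \<open>t'c'\<close> by congruence.\<close>
  obtain b where b: "T t b c" "D t w = D t b" "D w c' = D b c"
    using transfer_between[of t w c' t c] w eq t by blast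
  have et: "D t c' = D t c" "D t' c' = D t' c" using eq t t' by blast+
  have et': "D c' t' = D c t'" using et(2) D_comm[of t' c'] D_comm[of t' c] by argo
  have "D w t' = D b t'"
    by (rule inner_five_seg[OF w(1) b(1) et(1) b(3) refl et'])
  then have 1: "D t' w = D t' b" using D_comm[of t' w] D_comm[of t' b] by argo
  have 2: "D w c = D b c'"
    by (rule inner_five_seg[OF w(1) b(1) et(1) b(3) et(1)[symmetric] D_comm])
  have b': "T t' b c'"
    by (rule T_cong[OF w(2) 1 2 et(2)[symmetric]])
  have ab: "a \<noteq> b"
  proof
    assume "a = b"
    then have "a = t" using t b T_antisym[of a t c] by simp
    then show False using nc t by blast
  qed
  have tc: "t \<noteq> c" "t' \<noteq> c'" using t t' nc by auto
  have tac: "Col t c a" "Col t c b" "Col t' c' a" "Col t' c' b"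
    using t t' b b' T_sym unfolding Col_def by blast+
  have l: "Col a b c" "Col a b c'" "Col a b t" "Col a b t'"
    using Col_trans3[of t c a b] Col_trans3[of t' c' a b] tc tac by simp_all
  have cc: "c \<noteq> c'" using S_fixed[of s c] c'(1) nc s by auto
  have ls: "Col a b s" using Col_T[OF l(1,2) S_T(1)[of c s, folded c'(1)] ab] .
  have one: "x = y" if "Col u v x" "Col a b x" "Col u v y" "Col a b y" for x y
  proof (rule ccontr)
    assume n: "x \<noteq> y"
    have "Col x y c" using Col_trans3[of a b x y c] ab that l by blast
    then show False using Col_line[of u v x y c] that uv n nc by blast
  qed
  have "t = s" "t' = s" using one t t' l ls s by blast+
  then have "T a s c" "T a s c'" "a \<noteq> s" using t t' nc by auto
  then have "T s c c' \<or> T s c' c" using connectivity2 by blast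
  moreover have "D s c' = D s c" using c' S_D by blast
  ultimately show False using ray_unique[of s c c'] cc by simp
qed

text \<open>Reflecting \<open>b\<close> in the midpoint of the two feet gives a point
  \<open>b'\<close> opposite to \<open>b\<close> and on the perpendicular at \<open>s\<close>, hence
  on the ray from \<open>s\<close> to \<open>c\<close> or to \<open>c'\<close>. Moving along this
  ray keeps the side.\<close>

lemma opp_mirror:
  assumes uv: "u \<noteq> v" and s: "Col u v s" and c': "c' = S s c" "D u c' = D u c" "D v c' = D v c"
    and nb: "\<not> Col u v b" and nc: "\<not> Col u v c"
  shows "opp u v b c \<or> opp u v b c'"
proof -
  obtain r where r: "Col u v r" "D u (S r b) = D u b" "D v (S r b) = D v b" using foot nb by blast
  obtain m where m: "mid r m s" using ex_mid by blast
  then have Sm: "S m r = s" "S m s = r" using S_eqI mid_sym by auto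
  have ml: "Col u v m" using Col_T[OF r(1) s _ uv] m unfolding mid_def by blast
  have nc': "\<not> Col u v c'"
  proof
    assume c: "Col u v c'"
    have "Col s c' c" using S_Col(1)[of s c] c'(1) Col_perm(3) by blast
    moreover have "s \<noteq> c'" using S_eq_center[of s c] c'(1) s nc by auto
    ultimately
    show False using Col_line[OF s c] uv nc by blast
  qed
  obtain e where e: "Col u v e" "e \<noteq> s" using uv Col_triv by metis
  have Sme: "Col u v (S m e)"
  proof (cases "m = e")
    case True then show ?thesis using e by simp
  next
    case False then show ?thesis using Col_line[OF ml e(1) S_Col(1)] uv by blast
  qed
  define b' where "b' = S m b"
  have "Per (S m e) r b" using D_foot[OF uv r(2,3) Sme] unfolding Per_def by simp
  then have "Per (S m e) (S m s) (S m b')" unfolding b'_def using Sm by simp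
  then have "Per e s b'" using S_Per_iff by blast
  then have 1: "D b' e = D b' (S s e)" using Per_sym unfolding Per_def by blast
  have "Per e s c" using D_foot[OF uv c'(2,3)[unfolded c'(1)] e(1)] unfolding Per_def by simp
  then have 2: "D c e = D c (S s e)" using Per_sym unfolding Per_def by blast
  have "e \<noteq> S s e" using S_fixed e by metis
  \<comment> \<open>Two-dimensionality enters: \<open>s\<close>, \<open>b'\<close>, \<open>c\<close>
    are equidistant from \<open>e\<close> and \<open>S s e\<close>.\<close>
  then have "Col s b' c" using upper_dim[of e "S s e" s b' c] 1 2 S_D[of s e] unfolding Col_def by simp
  then consider "T s b' c" | "T s c b'" | "T c s b'" unfolding Col_def using T_sym by blast
  moreover have Sb: "S m b' = b" unfolding b'_def by simp
  have nb': "\<not> Col u v b'"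
  proof
    assume c: "Col u v b'"
    have "Col m b' b" using S_Col(1)[of m b] b'_def Col_perm(3) by blast
    moreover have "m \<noteq> b'" using S_eq_center[of m b] b'_def ml nb by auto
    ultimately
    show False using Col_line[OF ml c] uv nb by blast
  qed
  have o: "opp u v b' b" unfolding opp_def using nb nb' ml S_T Sb by metis
  have cs: "c \<noteq> s" "b' \<noteq> s" "c' \<noteq> s" using nc nb' nc' s by auto
  have out: "opp u v b d" if "T s b' d" for d
    using out_move[OF uv nb' ml Sb s that] cs opp_sym by blast
  have inw: "opp u v b d" if "T s d b'" "d \<noteq> s" for d
    using in_move[OF uv o s that] opp_sym by blast
  ultimately show ?thesis
  proof cases
    case 3
    have "T c s c'" using S_T c' by blast
    then have "T s b' c' \<or> T s c' b'" using connectivity2 3 cs by blast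
    then show ?thesis using out inw cs by blast
  qed (use out inw cs in blast)+
qed

text \<open>Moving outward is reduced to moving inward: if \<open>b\<close> were opposite to the
  mirror image of \<open>c\<close>, so would be \<open>a\<close>, which is impossible; hence
  \<open>b\<close> is opposite to \<open>c\<close> itself.\<close>

lemma opp_ray:
  assumes uv: "u \<noteq> v" and o: "opp u v a c" and r: "Col u v r" "T r a b \<or> T r b a" "b \<noteq> r"
  shows "opp u v b c"
proof (cases "T r b a")
  case True
  then show ?thesis using in_move assms by blast
next
  case False
  then have rab: "T r a b" using r by blast
  have nc: "\<not> Col u v a" "\<not> Col u v c" using o unfolding opp_def by auto
  have ar: "a \<noteq> r" using nc r by blast
  have nb: "\<not> Col u v b" using Col_T[OF r(1) _ rab uv] nc by blast
  obtain s where s: "Col u v s" "D u (S s c) = D u c" "D v (S s c) = D v c" using foot nc by blast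
  have "\<not> opp u v a (S s c)"
    using opp_both_mirror_False[OF uv s(1) refl s(2,3) o] by blast
  then have "\<not> opp u v b (S s c)" using in_move[OF uv _ r(1) rab ar] by blast
  then show ?thesis using opp_mirror[OF uv s(1) refl s(2,3) nb nc(2)] by blast
qed

end

section \<open>From line-circle to segment-circle continuity\<close>

locale line_circle_plane = tarski_plane +
  assumes line_circle: "\<lbrakk>Col u v p; u \<noteq> v; T a p b\<rbrakk> \<Longrightarrow>
    \<exists>y z. Col u v y \<and> Col u v z \<and> D a y = D a b \<and> D a z = D a b \<and> T y p z \<and> (p \<noteq> b \<longrightarrow> y \<noteq> z)"
begin

lemma segment_circle:
  assumes h: "D a x = D a p" "T a x b" "T a b y" "D a y = D a q"
  shows "\<exists>z. T p z q \<and> D a z = D a b"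
proof (cases "p = q")
  case True
  \<comment> \<open>When \<open>p = q\<close>, the points \<open>x\<close>, \<open>b\<close>,
    \<open>y\<close> coincide and \<open>p\<close> itself lies on the circle.\<close>
  then have "x = y" using h ray_unique[of a x y] T_exch2 by metis
  then have "x = b" using h T_inner2 T_same by metis
  then show ?thesis using h T_left by metis
next
  case pq: False
  \<comment> \<open>\<open>p\<close> is not outside the circle, so it lies between \<open>a\<close>
    and a point \<open>b'\<close> of the circle, as \<open>line_circle\<close> requires.\<close>
  obtain b' where b': "T a p b'" "D p b' = D x b" using extend by blast
  then have ab': "D a b' = D a b" using sum_segs h by metis
  obtain y1 z1 where yz: "Col p q y1" "Col p q z1" "D a y1 = D a b" "D a z1 = D a b" "T y1 p z1"
    using line_circle[of p q p a b'] pq b' ab' by auto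
  have "\<exists>w w'. Col p q w \<and> Col p q w' \<and> D a w = D a b \<and> D a w' = D a b \<and> T w p w' \<and> (T p w q \<or> T p q w)"
  proof (cases "T p y1 q \<or> T p q y1")
    case True then show ?thesis using yz by blast
  next
    case False
    then have "T q p y1" using yz(1) unfolding Col_def using T_sym by blast
    moreover have "y1 \<noteq> p" using False by auto
    ultimately have "T p z1 q \<or> T p q z1" using connectivity2[of y1 p z1 q] yz T_sym by blast
    then show ?thesis using yz T_sym by blast
  qed
  then obtain w w' where w: "Col p q w" "Col p q w'" "D a w = D a b" "D a w' = D a b" "T w p w'"
    "T p w q \<or> T p q w" by blast
  show ?thesis
  proof (cases "T p w q")
    case True then show ?thesis using w by blast
  next
    case False
    then have pqw: "T p q w" and qw: "q \<noteq> w" using w by auto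
    then have qp: "T w' q w" using w T_exch T_sym by blast
    have "q \<noteq> w'" using w pqw pq T_antisym T_sym by metis
    have ne: "D a q \<noteq> D a b"
    proof
      assume e: "D a q = D a b"
      have "Col w' q w" using qp unfolding Col_def by blast
      then show False
        using circle_line_two[of w' q w a] e w \<open>q \<noteq> w'\<close> qw T_same qp by metis
    qed
    \<comment> \<open>The point \<open>v\<close> is strictly inside the circle through
      \<open>q\<close>. One of the two intersections given by \<open>line_circle\<close> is
      \<open>q\<close>; the other, \<open>k\<close>, lies beyond \<open>v\<close>.\<close>
    have far: "\<exists>k. Col p q k \<and> k \<noteq> q \<and> D a k = D a q \<and> T q v k"
      if v: "Col p q v" "D a v = D a b" for v
    proof -
      obtain b2 where b2: "T a v b2" "D v b2 = D b y" using extend by blast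
      then have ab2: "D a b2 = D a q" using sum_segs[of a v b2 a b y] h v by simp
      then have "v \<noteq> b2" using ne v by auto
      then obtain y2 z2 where 2: "Col p q y2" "Col p q z2" "D a y2 = D a q" "D a z2 = D a q"
        "T y2 v z2" "y2 \<noteq> z2"
        using line_circle[of p q v a b2] v pq b2 ab2 by auto
      have "Col y2 z2 q" using Col_trans3[of p q y2 z2 q] 2 pq by simp
      then have "y2 = q \<or> z2 = q" using circle_line_two[of y2 z2 q a] 2 by simp
      then show ?thesis using 2 T_sym by metis
    qed
    obtain k where k: "Col p q k" "k \<noteq> q" "D a k = D a q" "T q w k" using far w by blast
    obtain k' where k': "Col p q k'" "k' \<noteq> q" "D a k' = D a q" "T q w' k'" using far w by blast
    have "Col k k' q" using Col_trans3[of p q k k' q] k k' pq by simp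
    then have "k = k'" using circle_line_two[of k k' q a] k k' by simp
    then have "T q w w' \<or> T q w' w" using connectivity3 k k' by blast
    then show ?thesis using qp qw \<open>q \<noteq> w'\<close> T_antisym T_sym by metis
  qed
qed

end

section \<open>From segment-circle to line-circle continuity\<close>

locale segment_circle_plane = tarski_plane +
  assumes segment_circle: "\<lbrakk>D a x = D a p; T a x b; T a b y; D a y = D a q\<rbrakk> \<Longrightarrow>
    \<exists>z. T p z q \<and> D a z = D a b"
begin

text \<open>The points \<open>f\<close>, \<open>e\<close> span a line, \<open>f\<close> is the foot of \<open>a\<close> on it, and \<open>a\<close>, \<open>m\<close> span
  the image of this line under the reflection in the midpoint \<open>n\<close> of \<open>a\<close> and \<open>f\<close>.\<close>

lemma meets_if_not_parallel:
  assumes fe: "f \<noteq> e" and a: "\<not> Col f e a" and per: "Per e f a"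
    and n: "mid a n f" and m: "m = S n e" and z: "\<not> Col a m z"
  shows "\<exists>x. Col f e x \<and> Col a z x"
proof (cases "Col a z f")
  case True
  then show ?thesis by (meson Col_triv(2))
next
  case False
  have az: "a \<noteq> z" using z by auto
  have af: "a \<noteq> f" using a by auto
  define a' where "a' = S f a"
  have afa': "Col a f a'" unfolding a'_def by (rule S_Col)
  have "a \<noteq> a'" using S_fixed[of f a] af unfolding a'_def by auto
  have a'z: "\<not> Col a z a'"
  proof
    assume "Col a z a'"
    then have "Col a f z" using Col_trans[of a a' z f] \<open>a \<noteq> a'\<close> afa' Col_perm by blast
    then show False using False Col_perm by blast
  qed
  then obtain k where k: "Col a z k" "D a (S k a') = D a a'" "D z (S k a') = D z a'" using foot by blast
  \<comment> \<open>\<open>b\<close> is the mirror image of \<open>a'\<close> in the line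
    \<open>az\<close>. The circumcenter of \<open>a'\<close>, \<open>a\<close>, \<open>b\<close>
    will lie on two perpendicular bisectors, the lines \<open>fe\<close> and
    \<open>az\<close>.\<close>
  define b where "b = S k a'"
  have a'b: "a' \<noteq> b" using S_fixed[of k a'] k a'z unfolding b_def by auto
  \<comment> \<open>Otherwise \<open>a\<close> would halve \<open>a'b\<close>, and \<open>az\<close>
    would be perpendicular to \<open>af\<close> just as \<open>am\<close> is; then \<open>z\<close>
    would lie on \<open>am\<close>.\<close>
  have nc: "\<not> Col a' a b"
  proof
    assume c: "Col a' a b"
    have "\<not> (T a a' b \<or> T a b a')" using ray_unique[of a a' b] k a'b unfolding b_def by auto
    then have "mid a' a b" using c k T_sym unfolding Col_def mid_def b_def by metis
    then have "S a a' = b" using S_eqI by blast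
    then have zz: "D z a' = D z (S a a')" using k b_def by simp
    have Sn: "S n a = f" "S n f = a" using n S_eqI mid_sym by auto
    have "Per (S n e) (S n f) (S n a)" using per S_Per_iff by blast
    then have "Per m a f" using m Sn by simp
    then have "Per a' a m" using Per_Col[of f a m a'] Per_sym af afa' by metis
    then have "D m a' = D m (S a a')" using Per_sym unfolding Per_def by blast
    moreover have "a' \<noteq> S a a'" using S_fixed[of a a'] \<open>a \<noteq> a'\<close> by auto
    ultimately have "Col a m z"
      using upper_dim[of a' "S a a'" a m z] zz S_D unfolding Col_def by simp
    then show False using z by blast
  qed
  then obtain x where x: "D a' x = D a x" "D a' x = D b x" using circumcenter unfolding Col_def by blast
  have "Col f e x"
    using upper_dim[of a a' f e x] \<open>a \<noteq> a'\<close> per S_D x D_comm unfolding Per_def Col_def a'_def by metis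
  moreover have "Col a z x"
    using upper_dim[of a' b a z x] a'b k x D_comm unfolding b_def Col_def by metis
  ultimately show ?thesis by blast
qed

text \<open>The two lines are exchanged by \<open>S n\<close>, so the image of a common point is
  common as well. Then \<open>n\<close> lies on the line \<open>fe\<close>, and with
  \<open>f\<close> and \<open>n\<close> also \<open>a\<close>.\<close>

lemma image_disjoint:
  assumes fe: "f \<noteq> e" and a: "\<not> Col f e a"
    and n: "mid a n f" and m: "m = S n e" and k: "Col f e k" "Col a m k"
  shows False
proof -
  have Sn: "S n a = f" "S n f = a" "S n m = e" using n S_eqI mid_sym m by auto
  have am: "a \<noteq> m"
  proof
    assume "a = m"
    then have "f = e" using Sn by simp
    then show False using fe by simp
  qed
  have k': "Col f e (S n k)" "Col a m (S n k)"
    using S_Col_iff[of n a m k] S_Col_iff[of n f e k] k Sn m by simp_all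
  have "Col f e n"
  proof (cases "n = k")
    case True then show ?thesis using k by simp
  next
    case False
    then have "k \<noteq> S n k" using S_fixed by metis
    then show ?thesis using Col_line[of f e k "S n k" n] k k' S_Col fe by blast
  qed
  moreover have "f \<noteq> n" using Sn S_center a by (metis Col_triv(2))
  moreover have "Col f n a" using n T_sym unfolding mid_def Col_def by blast
  ultimately show False using Col_line[of f e f n a] a fe by simp
qed

text \<open>This provides the outside point on one side. The order of \<open>a\<close>,
  \<open>z\<close>, \<open>x\<close> comes from plane separation with respect to each of the two
  parallels.\<close>

lemma outer_point:
  assumes fe: "f \<noteq> e" and a: "\<not> Col f e a" and per: "Per e f a"
    and n: "mid a n f" and m: "m = S n e"
    and p: "Col f e p" "T a p b" "p \<noteq> b" and s: "Col a m s" "T a c s" "D a c = D a b" "c \<noteq> s"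
  shows "\<exists>z x. Col f e x \<and> T p z s \<and> T a z x \<and> D a z = D a b"
proof -
  have disj: False if "Col f e k" "Col a m k" for k
    using image_disjoint[OF fe a n m that] .
  have am: "a \<noteq> m" using disj[of f] m n S_eqI[OF mid_sym[OF n]] S_inj fe by metis
  obtain y where y: "T a b y" "D b y = D c s" using extend by blast
  then have "D a y = D a s" using sum_segs s by metis
  then obtain z where z: "T p z s" "D a z = D a b"
    using segment_circle[of a p p b y s] p y by blast
  have ab: "a \<noteq> b" using p T_same by blast
  have az: "a \<noteq> z" using z ab D_zero by metis
  have zs: "z \<noteq> s" using z s ray_unique[of a c s] by auto
  have sa: "s \<noteq> a" using s T_same by blast
  have zM: "\<not> Col a m z"
  proof
    assume "Col a m z"
    moreover have "Col s z p" using z T_sym unfolding Col_def by blast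
    ultimately have "Col a m p" using Col_line[of a m s z p] s am zs by blast
    then show False using disj p by blast
  qed
  then obtain x where x: "Col f e x" "Col a z x" using meets_if_not_parallel[OF fe a per n m] by blast
  have xM: "\<not> Col a m x" and sL: "\<not> Col f e s" using disj x s by blast+
  have zL: "\<not> Col f e z \<or> z = x"
  proof (rule ccontr)
    assume c: "\<not> ?thesis"
    moreover have "Col z x a" using x Col_perm by blast
    ultimately show False using Col_line[of f e z x a] a fe x by blast
  qed
  \<comment> \<open>Otherwise \<open>am\<close> separates \<open>z\<close> from \<open>x\<close>,
    and hence \<open>p\<close> from \<open>x\<close>; but these two lie on the parallel
    \<open>fe\<close>.\<close>
  have 1: "\<not> T z a x"
  proof
    assume "T z a x"
    then have "opp a m z x" using zM xM unfolding opp_def by (meson Col_triv(2))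
    moreover have "p \<noteq> s" using sL p by blast
    ultimately have "opp a m p x" using opp_ray[of a m z x s p] am s T_sym[OF z(1)] by blast
    then obtain t where "Col a m t" "T p t x" unfolding opp_def by blast
    then show False using Col_T[of f e p x t] p x fe disj by blast
  qed
  \<comment> \<open>If \<open>z\<close> is not \<open>x\<close>, then \<open>fe\<close> separates
    \<open>z\<close> from \<open>a\<close>, and hence \<open>s\<close> from \<open>a\<close>; but
    these two lie on the parallel \<open>am\<close>.\<close>
  have 2: "T a z x" if "T a x z"
  proof (cases "z = x")
    case False
    then have "opp f e z a" using zL a x T_sym[OF that] unfolding opp_def by blast
    moreover have "s \<noteq> p" using sL p by blast
    ultimately have "opp f e s a" using opp_ray[of f e z a p s] fe p z by blast
    then obtain t where "Col f e t" "T s t a" unfolding opp_def by blast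
    then show ?thesis using Col_T[of a m s a t] s am disj by auto
  qed simp
  have "T a z x" using 1 2 x T_sym unfolding Col_def by blast
  then show ?thesis using x z by blast
qed

text \<open>Points \<open>s1\<close>, \<open>s2\<close> of the parallel, symmetric about
  \<open>a\<close> and outside the circle, lead to points \<open>x1\<close>, \<open>x2\<close> of
  the given line. These have \<open>p\<close> between them, and the segments from \<open>p\<close>
  to them meet the circle.\<close>

lemma line_circle_off_center:
  assumes uv: "u \<noteq> v" and p: "Col u v p" "T a p b" "p \<noteq> b" and a: "\<not> Col u v a"
  shows "\<exists>y z. Col u v y \<and> Col u v z \<and> D a y = D a b \<and> D a z = D a b \<and> T y p z \<and> y \<noteq> z"
proof -
  \<comment> \<open>The line is spanned anew by the foot \<open>f\<close> of \<open>a\<close> and a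
    second point \<open>e\<close>.\<close>
  obtain f where f: "Col u v f" "D u (S f a) = D u a" "D v (S f a) = D v a" using foot a by blast
  obtain e where e: "Col u v e" "e \<noteq> f" using uv Col_triv by metis
  have per: "Per e f a" using D_foot[OF uv f(2,3) e(1)] unfolding Per_def by simp
  have l: "Col f e x \<longleftrightarrow> Col u v x" for x
    using Col_trans3[of u v f e x] Col_line[of u v f e x] uv f e by blast
  obtain n where n: "mid a n f" using ex_mid by blast
  define m where "m = S n e"
  have fe: "f \<noteq> e" and afe: "\<not> Col f e a" and pfe: "Col f e p" using e l a p by auto
  have disj: False if "Col f e k" "Col a m k" for k
    using image_disjoint[OF fe afe n m_def that] .
  have am: "a \<noteq> m" using m_def S_eqI[OF mid_sym[OF n]] S_inj fe by metis
  have ap: "a \<noteq> p" using a p by blast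
  obtain c1 where c1: "T m a c1" "D a c1 = D a b" using extend by blast
  obtain s1 where s1: "T a c1 s1" "c1 \<noteq> s1" using extend_proper by blast
  have ab: "a \<noteq> b" using p T_same by blast
  have ac1: "a \<noteq> c1" using c1 ab D_zero by metis
  have "Col m a s1" using T_outer2[OF c1(1) s1(1) ac1] unfolding Col_def by blast
  then have s1M: "Col a m s1" using Col_perm by blast
  define s2 where "s2 = S a s1"
  have s1a: "s1 \<noteq> a" using s1 T_same by blast
  have "Col a s1 s2" unfolding s2_def by (rule S_Col)
  then have s2M: "Col a m s2" using Col_line[of a m a s1 s2] am s1M s1a by simp
  define c2 where "c2 = S a c1"
  have s2: "T a c2 s2" "D a c2 = D a b" "c2 \<noteq> s2"
    using S_T_iff[of a a c1 s1] s1 c1 S_D[of a c1] S_inj unfolding s2_def c2_def by auto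
  obtain z1 x1 where 1: "Col f e x1" "T p z1 s1" "T a z1 x1" "D a z1 = D a b"
    using outer_point[OF fe afe per n m_def pfe p(2,3) s1M s1(1) c1(2) s1(2)] by blast
  obtain z2 x2 where 2: "Col f e x2" "T p z2 s2" "T a z2 x2" "D a z2 = D a b"
    using outer_point[OF fe afe per n m_def pfe p(2,3) s2M s2] by blast
  have pz: "z \<noteq> p" if "D a z = D a b" for z
    using that p ray_unique[of a p b] by auto
  have xa: "x1 \<noteq> a" "x2 \<noteq> a" using 1 2 l a by auto
  have pM: "\<not> Col a m p" using disj pfe by blast
  have sp: "\<not> Col a p s" if "Col a m s" "s \<noteq> a" for s
  proof
    assume "Col a p s"
    then have "Col a s p" using Col_perm by blast
    then show False using Col_line[of a m a s p] that am pM by simp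
  qed
  have s2a: "s2 \<noteq> a" using s1a S_eq_center unfolding s2_def by metis
  have "opp a p s1 s2" unfolding opp_def
    using sp s1M s2M s1a s2a S_T(1)[of s1 a] unfolding s2_def by (meson Col_triv(2))
  \<comment> \<open>Sides of the line \<open>ap\<close> are kept along rays from \<open>p\<close>
    (from \<open>s1\<close> to \<open>z1\<close>) and from \<open>a\<close> (from \<open>z1\<close>
    to \<open>x1\<close>), and in the same way for \<open>s2\<close>, \<open>z2\<close>,
    \<open>x2\<close>.\<close>
  then have "opp a p z1 s2" using opp_ray[of a p s1 s2 p z1] ap 1 pz by simp
  then have "opp a p x1 s2" using opp_ray[of a p z1 s2 a x1] ap 1 xa by simp
  then have "opp a p s2 x1" by (rule opp_sym)
  then have "opp a p z2 x1" using opp_ray[of a p s2 x1 p z2] ap 2 pz by simp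
  then have "opp a p x2 x1" using opp_ray[of a p z2 x1 a x2] ap 2 xa by simp
  then obtain t where t: "Col a p t" "T x2 t x1" unfolding opp_def by blast
  have tL: "Col f e t" using Col_T[of f e x2 x1 t] 1 2 t fe by blast
  have "t = p"
  proof (rule ccontr)
    assume n: "t \<noteq> p"
    moreover have "Col p t a" using t Col_perm by blast
    ultimately show False using Col_line[of f e p t a] fe afe pfe tL by blast
  qed
  then have x: "T x1 p x2" using t T_sym by blast
  have hit: "\<exists>y. T p y x \<and> D a y = D a b" if h: "T a z x" "D a z = D a b" for z x
  proof -
    obtain w where w: "T a b w" "D b w = D z x" using extend by blast
    then have "D a w = D a x" using sum_segs h by metis
    then show ?thesis using segment_circle[of a p p b w x] p w by blast
  qed
  obtain y1 where y1: "T p y1 x1" "D a y1 = D a b" using hit 1 by blast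
  obtain y2 where y2: "T p y2 x2" "D a y2 = D a b" using hit 2 by blast
  have "T y1 p x2" using T_inner2[of x1 y1 p x2] T_sym[OF y1(1)] x by blast
  then have y: "T y1 p y2" using T_inner[of y1 p x2 y2] y2 by blast
  have "Col u v y1" "Col u v y2"
    using Col_T[of f e p x1 y1] Col_T[of f e p x2 y2] pfe 1 2 y1 y2 fe l by blast+
  moreover have "y1 \<noteq> y2" using y T_same[of y1 p] pz y1 by metis
  ultimately show ?thesis using y y1 y2 by blast
qed

lemma line_circle:
  assumes uv: "u \<noteq> v" and p: "Col u v p" "T a p b"
  shows "\<exists>y z. Col u v y \<and> Col u v z \<and> D a y = D a b \<and> D a z = D a b \<and> T y p z \<and> (p \<noteq> b \<longrightarrow> y \<noteq> z)"
proof -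
  consider "p = b" | "p \<noteq> b" "\<not> Col u v a" | "p \<noteq> b" "Col u v a" by blast
  then show ?thesis
  proof cases
    case 1 then show ?thesis using p T_left by blast
  next
    case 2 then show ?thesis using line_circle_off_center uv p by metis
  next
    case 3
    have ab: "a \<noteq> b" using p 3 T_same by blast
    \<comment> \<open>\<open>q\<close> is \<open>p\<close> unless \<open>p\<close> is the center, so
      that \<open>y\<close> is laid off on the side of \<open>a\<close> away from
      \<open>p\<close>.\<close>
    obtain q where q: "Col u v q" "q \<noteq> a" "p = a \<or> q = p" using uv p(1) Col_triv by metis
    obtain y where y: "T q a y" "D a y = D a b" using extend by blast
    define z where "z = S a y"
    have z: "D a z = D a b" "T y a z" using S_D S_T y unfolding z_def by auto
    have ya: "y \<noteq> a" using y ab D_zero by metis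
    have "Col q a y" using y unfolding Col_def by blast
    then have yl: "Col u v y" using Col_line[of u v q a y] q 3 uv by blast
    moreover have zl: "Col u v z" using Col_line[of u v y a z] yl 3 uv ya z unfolding Col_def by blast
    moreover have "y \<noteq> z" using z ya T_same by blast
    moreover have "T y p z"
    proof (cases "p = a")
      case True then show ?thesis using z by simp
    next
      case False
      then have "T y a p" using y q T_sym by blast
      then have "T a p z \<or> T a z p" using connectivity2[of y a p z] ya z by blast
      \<comment> \<open>\<open>p\<close> is not outside the circle: \<open>z\<close> between
        \<open>a\<close> and \<open>p\<close> forces \<open>z = b\<close> and then
        \<open>z = p\<close>.\<close>
      moreover have "T a p z" if "T a z p"
      proof -
        have "T a z b" using that p T_exch2 by blast
        then have "z = b" using ray_unique[of a z b] z by blast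
        then have "z = p" using that p T_antisym[of z p a] T_sym by metis
        then show ?thesis by simp
      qed
      ultimately have "T a p z" by blast
      then show ?thesis using T_exch[of y a z p] z by blast
    qed
    ultimately show ?thesis using y z by blast
  qed
qed

end

section \<open>Models of the two theories\<close>

text \<open>A ray, ordered by betweenness, has no last point.\<close>

lemma infinite_carrier:
  assumes p: "p \<in> U" "q \<in> U" "p \<noteq> q"
    and A2: "\<And>a b c d e f. \<lbrakk>a \<in> U; b \<in> U; c \<in> U; d \<in> U; e \<in> U; f \<in> U; C a b c d; C a b e f\<rbrakk> \<Longrightarrow> C c d e f"
    and A3: "\<And>a b c. \<lbrakk>a \<in> U; b \<in> U; c \<in> U; C a b c c\<rbrakk> \<Longrightarrow> a = b"
    and refl: "\<And>a b. \<lbrakk>a \<in> U; b \<in> U\<rbrakk> \<Longrightarrow> C a b a b"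
    and ext: "\<And>q a b c. \<lbrakk>q \<in> U; a \<in> U; b \<in> U; c \<in> U; q \<noteq> a\<rbrakk> \<Longrightarrow> \<exists>x\<in>U. t q a x \<and> C a x b c"
    and A5: "\<And>a b c d a' b' c' d'. \<lbrakk>a \<in> U; b \<in> U; c \<in> U; d \<in> U; a' \<in> U; b' \<in> U; c' \<in> U; d' \<in> U;
      a \<noteq> b; t a b c; t a' b' c'; C a b a' b'; C b c b' c'; C a d a' d'; C b d b' d'\<rbrakk> \<Longrightarrow> C c d c' d'"
    and left: "\<And>a b. \<lbrakk>a \<in> U; b \<in> U\<rbrakk> \<Longrightarrow> t a a b"
    and same: "\<And>a b. \<lbrakk>a \<in> U; b \<in> U; t a b a\<rbrakk> \<Longrightarrow> a = b"
    and sym: "\<And>a b c. \<lbrakk>a \<in> U; b \<in> U; c \<in> U; t a b c\<rbrakk> \<Longrightarrow> t c b a"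
    and inner: "\<And>a b c d. \<lbrakk>a \<in> U; b \<in> U; c \<in> U; d \<in> U; t a b d; t b c d\<rbrakk> \<Longrightarrow> t a b c"
  shows "infinite U"
proof
  assume fin: "finite U"
  have csym: "C c d a b" if "C a b c d" "a \<in> U" "b \<in> U" "c \<in> U" "d \<in> U" for a b c d
    using A2[of a b c d a b] refl[of a b] that by simp
  have ctrans: "C a b e f" if "C a b c d" "C c d e f" "a \<in> U" "b \<in> U" "c \<in> U" "d \<in> U" "e \<in> U" "f \<in> U"
    for a b c d e f using A2[of c d a b e f] csym[of a b c d] that by simp
  have inner2: "t b c d" if "t a b c" "t a c d" "a \<in> U" "b \<in> U" "c \<in> U" "d \<in> U" for a b c d
    using inner[of d c b a] sym[of a b c] sym[of a c d] sym[of d c b] that by simp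
  have outer: "t a c d" if t: "t a b c" "t b c d" "b \<noteq> c" and U: "a \<in> U" "b \<in> U" "c \<in> U" "d \<in> U" for a b c d
  proof -
    have "a \<noteq> c" using same[of a b] t U by auto
    then obtain x where x: "x \<in> U" "t a c x" "C c x c d" using ext[of a c c d] U by auto
    have "t b c x" using inner2[of a b c x] x t U by simp
    then have "C x x d x" using A5[of b c x x b c d x] t U x refl by simp
    then have "d = x" using A3[of d x x] csym x U by simp
    then show ?thesis using x by simp
  qed
  \<comment> \<open>A finite carrier would have a maximal element for this strict order. It cannot
    be \<open>p\<close>, which precedes \<open>q\<close>, nor any other point \<open>m\<close>,
    since \<open>pm\<close> can be prolonged by \<open>pq\<close>.\<close>
  define R where "R x y \<longleftrightarrow> t p x y \<and> x \<noteq> y" for x y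
  have R_trans: "R x z" if R: "R x y" "R y z" and U: "x \<in> U" "y \<in> U" "z \<in> U" for x y z
  proof -
    have 1: "t x y z" using inner2[of p x y z] R U p unfolding R_def by simp
    then have 2: "t z y x" using sym U by simp
    have "t y x p" using sym[of p x y] R U p unfolding R_def by simp
    then have "t z x p" using outer[of z y x p] 2 R U p unfolding R_def by auto
    then have "t p x z" using sym U p by simp
    moreover have "x \<noteq> z" using 1 same[of x y] R U unfolding R_def by auto
    ultimately show ?thesis unfolding R_def by simp
  qed
  have "asymp_on U R" using R_trans R_def by (intro asymp_onI) metis
  moreover have "transp_on U R" using R_trans by (intro transp_onI) metis
  ultimately obtain m where m: "m \<in> U" "\<forall>x\<in>U. x \<noteq> m \<longrightarrow> \<not> R m x"
    using Finite_Set.bex_max_element[of U R] fin p by auto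
  show False
  proof (cases "m = p")
    case True
    then show ?thesis using m p left[of p q] unfolding R_def by auto
  next
    case False
    then obtain x where x: "x \<in> U" "t p m x" "C m x p q" using ext[of p m p q] m p by auto
    have "m \<noteq> x" using A3[of p q m] csym[of m x p q] x m p by auto
    then show ?thesis using m x unfolding R_def by auto
  qed
qed

section \<open>Meaning of the axioms in a structure\<close>

lemma sat_connectives [simp]:
  "sat U R C e (\<^bold>\<not> \<phi>) \<longleftrightarrow> \<not> sat U R C e \<phi>"
  "sat U R C e (\<phi> \<^bold>\<and> \<psi>) \<longleftrightarrow> sat U R C e \<phi> \<and> sat U R C e \<psi>"
  by auto

text \<open>Serves both languages: \<open>f\<close> is the formula for non-strict betweenness,
  primitive or defined, and \<open>t\<close> is its meaning.\<close>

context
  fixes U :: "'a set" and R :: "'p \<Rightarrow> 'a \<Rightarrow> 'a \<Rightarrow> 'a \<Rightarrow> bool" and C f t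
  assumes f: "\<And>e x y z. sat U R C e (f x y z) \<longleftrightarrow> t (e x) (e y) (e z)"
begin

lemma sat_Col: "sat U R C e (Col f x y z) \<longleftrightarrow>
    t (e x) (e y) (e z) \<or> t (e y) (e z) (e x) \<or> t (e z) (e x) (e y)"
  by (auto simp: Col_def f)

lemma sat_A5: "sat U R C e (A5 f) \<longleftrightarrow> (\<forall>a\<in>U. \<forall>b\<in>U. \<forall>c\<in>U. \<forall>d\<in>U. \<forall>a'\<in>U. \<forall>b'\<in>U. \<forall>c'\<in>U. \<forall>d'\<in>U.
    a \<noteq> b \<and> t a b c \<and> t a' b' c' \<and> C a b a' b' \<and> C b c b' c' \<and> C a d a' d' \<and> C b d b' d'
    \<longrightarrow> C c d c' d')"
  unfolding A5_def by (simp add: f conj_ac)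

lemma sat_A8: "sat U R C e (A8 f) \<longleftrightarrow> (\<exists>a\<in>U. \<exists>b\<in>U. \<exists>c\<in>U. \<not> (t a b c \<or> t b c a \<or> t c a b))"
  by (simp add: A8_def sat_Col)

lemma sat_A9: "sat U R C e (A9 f) \<longleftrightarrow> (\<forall>a\<in>U. \<forall>b\<in>U. \<forall>p\<in>U. \<forall>q\<in>U. \<forall>r\<in>U.
    a \<noteq> b \<and> C p a p b \<and> C q a q b \<and> C r a r b \<longrightarrow> t p q r \<or> t q r p \<or> t r p q)"
  unfolding A9_def by (simp add: sat_Col conj_ac)

lemma sat_A10_3: "sat U R C e (A10_3 f) \<longleftrightarrow> (\<forall>a\<in>U. \<forall>b\<in>U. \<forall>c\<in>U.
    \<not> (t a b c \<or> t b c a \<or> t c a b) \<longrightarrow> (\<exists>x\<in>U. C a x b x \<and> C a x c x))"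
  by (simp add: A10_3_def sat_Col)

end

lemma sat_A1: "sat U R C e A1 \<longleftrightarrow> (\<forall>a\<in>U. \<forall>b\<in>U. C a b b a)"
  by (simp add: A1_def)

lemma sat_A2: "sat U R C e A2 \<longleftrightarrow> (\<forall>a\<in>U. \<forall>b\<in>U. \<forall>p\<in>U. \<forall>q\<in>U. \<forall>r\<in>U. \<forall>s\<in>U.
    C a b p q \<and> C a b r s \<longrightarrow> C p q r s)"
  by (simp add: A2_def)

lemma sat_A3: "sat U R C e A3 \<longleftrightarrow> (\<forall>a\<in>U. \<forall>b\<in>U. \<forall>c\<in>U. C a b c c \<longrightarrow> a = b)"
  by (simp add: A3_def)

lemma sat_A4: "sat U (\<lambda>_. t) C e A4 \<longleftrightarrow> (\<forall>q\<in>U. \<forall>a\<in>U. \<forall>b\<in>U. \<forall>c\<in>U. \<exists>x\<in>U. t q a x \<and> C a x b c)"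
  by (simp add: A4_def)

lemma sat_A6: "sat U (\<lambda>_. t) C e A6 \<longleftrightarrow> (\<forall>a\<in>U. \<forall>b\<in>U. t a b a \<longrightarrow> a = b)"
  by (simp add: A6_def)

lemma sat_A7: "sat U (\<lambda>_. t) C e A7 \<longleftrightarrow> (\<forall>a\<in>U. \<forall>b\<in>U. \<forall>c\<in>U. \<forall>p\<in>U. \<forall>q\<in>U.
    t a p c \<and> t b q c \<longrightarrow> (\<exists>x\<in>U. t p x b \<and> t q x a))"
  by (simp add: A7_def)

lemma sat_segment_circle: "sat U (\<lambda>_. t) C e segment_circle \<longleftrightarrow>
    (\<forall>a\<in>U. \<forall>b\<in>U. \<forall>p\<in>U. \<forall>q\<in>U. \<forall>x\<in>U. \<forall>y\<in>U.
      C a x a p \<and> t a x b \<and> t a b y \<and> C a y a q \<longrightarrow> (\<exists>z\<in>U. t p z q \<and> C a z a b))"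
  unfolding segment_circle_def by simp blast

definition nonstrict_of :: "('a \<Rightarrow> 'a \<Rightarrow> 'a \<Rightarrow> bool) \<Rightarrow> 'a \<Rightarrow> 'a \<Rightarrow> 'a \<Rightarrow> bool" where
  "nonstrict_of b x y z \<longleftrightarrow> x = y \<or> y = z \<or> b x y z"

definition strict_of :: "('a \<Rightarrow> 'a \<Rightarrow> 'a \<Rightarrow> bool) \<Rightarrow> 'a \<Rightarrow> 'a \<Rightarrow> 'a \<Rightarrow> bool" where
  "strict_of t x y z \<longleftrightarrow> t x y z \<and> x \<noteq> y \<and> y \<noteq> z"

lemma sat_T_by_B: "sat U (\<lambda>_. b) C e (T_by_B x y z) \<longleftrightarrow> nonstrict_of b (e x) (e y) (e z)"
  by (auto simp: T_by_B_def nonstrict_of_def)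

lemma sat_B_by_T: "sat U (\<lambda>_. t) C e (B_by_T x y z) \<longleftrightarrow> strict_of t (e x) (e y) (e z)"
  by (auto simp: B_by_T_def strict_of_def)

lemma sat_A4i: "sat U (\<lambda>_. b) C e A4i \<longleftrightarrow> (\<forall>q\<in>U. \<forall>a\<in>U. \<forall>c\<in>U. \<forall>d\<in>U.
    q \<noteq> a \<longrightarrow> (\<exists>x\<in>U. nonstrict_of b q a x \<and> C a x c d))"
  by (simp add: A4i_def sat_T_by_B)

lemma sat_A6i: "sat U (\<lambda>_. b) C e A6i \<longleftrightarrow> (\<forall>x\<in>U. \<forall>y\<in>U. \<not> b x y x)"
  by (simp add: A6i_def)

lemma sat_A7i: "sat U (\<lambda>_. \<beta>) C e A7i \<longleftrightarrow> (\<forall>a\<in>U. \<forall>b\<in>U. \<forall>c\<in>U. \<forall>p\<in>U. \<forall>q\<in>U.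
    \<beta> a p c \<and> \<beta> b q c \<and>
      \<not> (nonstrict_of \<beta> a b c \<or> nonstrict_of \<beta> b c a \<or> nonstrict_of \<beta> c a b)
    \<longrightarrow> (\<exists>x\<in>U. \<beta> p x b \<and> \<beta> q x a))"
  by (simp add: A7i_def sat_Col[where f=T_by_B, OF sat_T_by_B])

lemma sat_A14i: "sat U (\<lambda>_. \<beta>) C e A14i \<longleftrightarrow> (\<forall>a\<in>U. \<forall>b\<in>U. \<forall>c\<in>U. \<beta> a b c \<longrightarrow> \<beta> c b a)"
  by (simp add: A14i_def)

lemma sat_A15i: "sat U (\<lambda>_. \<beta>) C e A15i \<longleftrightarrow> (\<forall>a\<in>U. \<forall>b\<in>U. \<forall>c\<in>U. \<forall>d\<in>U.
    \<beta> a b d \<and> \<beta> b c d \<longrightarrow> \<beta> a b c)"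
  by (simp add: A15i_def)

definition collinear :: "('a \<Rightarrow> 'a \<Rightarrow> 'a \<Rightarrow> bool) \<Rightarrow> 'a \<Rightarrow> 'a \<Rightarrow> 'a \<Rightarrow> bool" where
  "collinear t a b c \<longleftrightarrow> t a b c \<or> t b c a \<or> t c a b"

lemma sat_line_circle: "sat U (\<lambda>_. \<beta>) C e line_circle \<longleftrightarrow>
  (\<forall>a\<in>U. \<forall>b\<in>U. \<forall>p\<in>U. \<forall>u\<in>U. \<forall>v\<in>U.
    collinear (nonstrict_of \<beta>) u v p \<and> u \<noteq> v \<and> nonstrict_of \<beta> a p b
    \<longrightarrow> (\<exists>y\<in>U. \<exists>z\<in>U. collinear (nonstrict_of \<beta>) u v y \<and> collinear (nonstrict_of \<beta>) u v z \<and>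
      C a y a b \<and> C a z a b \<and> nonstrict_of \<beta> y p z \<and> (y = z \<longrightarrow> p = b)))"
  by (simp add: line_circle_def sat_T_by_B conj_ac
      sat_Col[where f=T_by_B, OF sat_T_by_B, folded collinear_def])

text \<open>Turns both translations into a change of the structure: the translated formula speaks
  about the relation defined by \<open>F\<close>.\<close>

lemma sat_replace_btw:
  assumes "\<And>e P x y z. sat U R C e (F P x y z) \<longleftrightarrow> R' P (e x) (e y) (e z)"
  shows "sat U R C e (replace_btw F \<phi>) \<longleftrightarrow> sat U R' C e \<phi>"
  by (induction \<phi> arbitrary: e) (simp_all add: assms)

lemma sat_to_B: "sat U (\<lambda>_. b) C e (to_B \<phi>) \<longleftrightarrow> sat U (\<lambda>_. nonstrict_of b) C e \<phi>"
  unfolding to_B_def by (rule sat_replace_btw) (rule sat_T_by_B)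

lemma sat_to_T: "sat U (\<lambda>_. t) C e (to_T \<phi>) \<longleftrightarrow> sat U (\<lambda>_. strict_of t) C e \<phi>"
  unfolding to_T_def by (rule sat_replace_btw) (rule sat_B_by_T)

lemma nonstrict_of_triv [simp]: "nonstrict_of \<beta> a a b" "nonstrict_of \<beta> a b b"
  by (simp_all add: nonstrict_of_def)

lemma tarski_geometryD:
  assumes "\<forall>\<gamma>\<in>tarski_geometry. sat U (\<lambda>_. t) C e \<gamma>"
  shows "sat U (\<lambda>_. t) C e (A1 :: tarski_fm)" "sat U (\<lambda>_. t) C e (A2 :: tarski_fm)"
    "sat U (\<lambda>_. t) C e (A3 :: tarski_fm)"
    "sat U (\<lambda>_. t) C e A4" "sat U (\<lambda>_. t) C e (A5 (Btw T))" "sat U (\<lambda>_. t) C e A6"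
    "sat U (\<lambda>_. t) C e A7" "sat U (\<lambda>_. t) C e (A8 (Btw T))" "sat U (\<lambda>_. t) C e (A9 (Btw T))"
    "sat U (\<lambda>_. t) C e (A10_3 (Btw T))" "sat U (\<lambda>_. t) C e segment_circle"
  using assms by (simp_all add: tarski_geometry_def)

lemma continuous_tarski_geometryD:
  assumes "\<forall>\<gamma>\<in>continuous_tarski_geometry. sat U (\<lambda>_. \<beta>) C e \<gamma>"
  shows "sat U (\<lambda>_. \<beta>) C e (A1 :: continuous_fm)" "sat U (\<lambda>_. \<beta>) C e (A2 :: continuous_fm)"
    "sat U (\<lambda>_. \<beta>) C e (A3 :: continuous_fm)"
    "sat U (\<lambda>_. \<beta>) C e A4i" "sat U (\<lambda>_. \<beta>) C e (A5 T_by_B)" "sat U (\<lambda>_. \<beta>) C e A6i"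
    "sat U (\<lambda>_. \<beta>) C e A7i" "sat U (\<lambda>_. \<beta>) C e (A8 T_by_B)" "sat U (\<lambda>_. \<beta>) C e (A9 T_by_B)"
    "sat U (\<lambda>_. \<beta>) C e (A10_3 T_by_B)" "sat U (\<lambda>_. \<beta>) C e A14i" "sat U (\<lambda>_. \<beta>) C e A15i"
    "sat U (\<lambda>_. \<beta>) C e line_circle"
  using assms by (simp_all add: continuous_tarski_geometry_def)

lemma sat_Btw: "sat U (\<lambda>_. t) C e (Btw P x y z) \<longleftrightarrow> t (e x) (e y) (e z)"
  by simp

lemmas sat_T = sat_A5[where f="Btw T" and R="\<lambda>_. t" and t=t for t, OF sat_Btw]
  sat_A8[where f="Btw T" and R="\<lambda>_. t" and t=t for t, OF sat_Btw] sat_A9[where f="Btw T" and R="\<lambda>_. t" and t=t for t, OF sat_Btw]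
  sat_A10_3[where f="Btw T" and R="\<lambda>_. t" and t=t for t, OF sat_Btw]

lemmas sat_B = sat_A5[where f=T_by_B, OF sat_T_by_B] sat_A8[where f=T_by_B, OF sat_T_by_B]
  sat_A9[where f=T_by_B, OF sat_T_by_B] sat_A10_3[where f=T_by_B, OF sat_T_by_B]

text \<open>The symmetry and inner transitivity that \<open>infinite_carrier\<close> asks for come
  from inner Pasch, in cases where its point satisfies \<open>t b x b\<close> and so equals
  \<open>b\<close>.\<close>

lemma tarski_infinite:
  assumes ax: "\<forall>\<gamma>\<in>tarski_geometry. sat U (\<lambda>_. t) C e \<gamma>"
  shows "infinite U"
proof -
  note A1 = tarski_geometryD(1)[OF ax, unfolded sat_A1, rule_format]
    and A2 = tarski_geometryD(2)[OF ax, unfolded sat_A2, rule_format]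
    and A3 = tarski_geometryD(3)[OF ax, unfolded sat_A3, rule_format]
    and A4 = tarski_geometryD(4)[OF ax, unfolded sat_A4, rule_format]
    and A5 = tarski_geometryD(5)[OF ax, unfolded sat_T, rule_format]
    and A6 = tarski_geometryD(6)[OF ax, unfolded sat_A6, rule_format]
    and A7 = tarski_geometryD(7)[OF ax, unfolded sat_A7, rule_format]
    and A8 = tarski_geometryD(8)[OF ax, unfolded sat_T]
  have right: "t a b b" if "a \<in> U" "b \<in> U" for a b
    using A4[of a b b b] A3[of b _ b] that by blast
  have sym: "t c b a" if U: "a \<in> U" "b \<in> U" "c \<in> U" "t a b c" for a b c
  proof -
    obtain x where "x \<in> U" "t b x b" "t c x a"
      using A7[of a b c b c] right[of b c] U by blast
    then show ?thesis using A6[of b x] U by auto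
  qed
  obtain p q where pq: "p \<in> U" "q \<in> U" "p \<noteq> q" using A8 right by blast
  show ?thesis
  proof (rule infinite_carrier[OF pq, where C = C and t = t])
    show "C a b a b" if "a \<in> U" "b \<in> U" for a b using A2[of b a a b a b] A1[of b a] that by simp
    show "t a a b" if "a \<in> U" "b \<in> U" for a b using sym right that by simp
    show "t a b c" if U: "a \<in> U" "b \<in> U" "c \<in> U" "d \<in> U" and t: "t a b d" "t b c d" for a b c d
    proof -
      obtain x where x: "x \<in> U" "t b x b" "t c x a" using A7[of a b d b c] U t by blast
      then have "t c b a" using A6[of b x] U by auto
      then show ?thesis using sym U by simp
    qed
    show "\<exists>x\<in>U. t q a x \<and> C a x b c" if "q \<in> U" "a \<in> U" "b \<in> U" "c \<in> U" for q a b c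
      using A4 that by simp
    show "C c d c' d'" if "a \<in> U" "b \<in> U" "c \<in> U" "d \<in> U" "a' \<in> U" "b' \<in> U" "c' \<in> U" "d' \<in> U"
      "a \<noteq> b" "t a b c" "t a' b' c'" "C a b a' b'" "C b c b' c'" "C a d a' d'" "C b d b' d'"
      for a b c d a' b' c' d' using A5[of a b c d a' b' c' d'] that by simp
    show "t c b a" if "a \<in> U" "b \<in> U" "c \<in> U" "t a b c" for a b c using sym that .
    show "C p q r s" if "a \<in> U" "b \<in> U" "p \<in> U" "q \<in> U" "r \<in> U" "s \<in> U" "C a b p q" "C a b r s"
      for a b p q r s using A2[of a b p q r s] that by simp
    show "a = b" if "a \<in> U" "b \<in> U" "c \<in> U" "C a b c c" for a b c using A3[of a b c] that by simp
    show "a = b" if "a \<in> U" "b \<in> U" "t a b a" for a b using A6[of a b] that by simp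
  qed
qed

lemma nonstrict_inner:
  assumes "\<And>a b c d. \<lbrakk>a \<in> U; b \<in> U; c \<in> U; d \<in> U; \<beta> a b d; \<beta> b c d\<rbrakk> \<Longrightarrow> \<beta> a b c"
    and "\<And>x y. \<lbrakk>x \<in> U; y \<in> U\<rbrakk> \<Longrightarrow> \<not> \<beta> x y x"
    and U: "a \<in> U" "b \<in> U" "c \<in> U" "d \<in> U" and t: "nonstrict_of \<beta> a b d" "nonstrict_of \<beta> b c d"
  shows "nonstrict_of \<beta> a b c"
proof -
  consider "a = b \<or> b = c" | "a \<noteq> b" "b \<noteq> c" "b = d" | "a \<noteq> b" "b \<noteq> c" "c = d"
    | "\<beta> a b d" "\<beta> b c d" using t unfolding nonstrict_of_def by blast
  then show ?thesis
  proof cases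
    case 2
    then show ?thesis using t assms(2)[of b c] U unfolding nonstrict_of_def by auto
  next
    case 4
    then show ?thesis using assms(1)[of a b c d] U unfolding nonstrict_of_def by simp
  qed (use t in \<open>auto simp: nonstrict_of_def\<close>)
qed

text \<open>\<open>infinite_carrier\<close> extends only from \<open>q \<noteq> a\<close>, which is
  just what \<open>A4i\<close> offers.\<close>

lemma continuous_infinite:
  assumes ax: "\<forall>\<gamma>\<in>continuous_tarski_geometry. sat U (\<lambda>_. \<beta>) C e \<gamma>"
  shows "infinite U"
proof -
  note A1 = continuous_tarski_geometryD(1)[OF ax, unfolded sat_A1, rule_format]
    and A2 = continuous_tarski_geometryD(2)[OF ax, unfolded sat_A2, rule_format]
    and A3 = continuous_tarski_geometryD(3)[OF ax, unfolded sat_A3, rule_format]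
    and A4 = continuous_tarski_geometryD(4)[OF ax, unfolded sat_A4i, rule_format]
    and A5 = continuous_tarski_geometryD(5)[OF ax, unfolded sat_B, rule_format]
    and A6 = continuous_tarski_geometryD(6)[OF ax, unfolded sat_A6i, rule_format]
    and A8 = continuous_tarski_geometryD(8)[OF ax, unfolded sat_B]
    and A14 = continuous_tarski_geometryD(11)[OF ax, unfolded sat_A14i, rule_format]
    and A15 = continuous_tarski_geometryD(12)[OF ax, unfolded sat_A15i, rule_format]
  obtain p q where pq: "p \<in> U" "q \<in> U" "p \<noteq> q" using A8 unfolding nonstrict_of_def by blast
  show ?thesis
  proof (rule infinite_carrier[OF pq, where C = C and t = "nonstrict_of \<beta>"])
    show "C a b a b" if "a \<in> U" "b \<in> U" for a b using A2[of b a a b a b] A1[of b a] that by simp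
    show "nonstrict_of \<beta> a a b" for a b by simp
    show "nonstrict_of \<beta> c b a" if "a \<in> U" "b \<in> U" "c \<in> U" "nonstrict_of \<beta> a b c" for a b c
      using A14[of a b c] that by (auto simp: nonstrict_of_def)
    show "a = b" if "a \<in> U" "b \<in> U" "nonstrict_of \<beta> a b a" for a b
      using A6[of a b] that by (auto simp: nonstrict_of_def)
    show "nonstrict_of \<beta> a b c" if U: "a \<in> U" "b \<in> U" "c \<in> U" "d \<in> U" and t: "nonstrict_of \<beta> a b d"
      "nonstrict_of \<beta> b c d" for a b c d
      using nonstrict_inner[of U \<beta> a b c d] A15 A6 U t by blast
    show "\<exists>x\<in>U. nonstrict_of \<beta> q a x \<and> C a x b c" if "q \<in> U" "a \<in> U" "b \<in> U" "c \<in> U" "q \<noteq> a" for q a b c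
      using A4 that by simp
    show "C c d c' d'" if "a \<in> U" "b \<in> U" "c \<in> U" "d \<in> U" "a' \<in> U" "b' \<in> U" "c' \<in> U" "d' \<in> U"
      "a \<noteq> b" "nonstrict_of \<beta> a b c" "nonstrict_of \<beta> a' b' c'" "C a b a' b'" "C b c b' c'" "C a d a' d'" "C b d b' d'"
      for a b c d a' b' c' d' using A5[of a b c d a' b' c' d'] that by simp
    show "C p q r s" if "a \<in> U" "b \<in> U" "p \<in> U" "q \<in> U" "r \<in> U" "s \<in> U" "C a b p q" "C a b r s"
      for a b p q r s using A2[of a b p q r s] that by simp
    show "a = b" if "a \<in> U" "b \<in> U" "c \<in> U" "C a b c c" for a b c using A3[of a b c] that by simp
  qed
qed

section \<open>Correspondence between the models of the two theories\<close>

definition length_class :: "('a \<Rightarrow> 'a \<Rightarrow> 'a \<Rightarrow> 'a \<Rightarrow> bool) \<Rightarrow> 'a \<Rightarrow> 'a \<Rightarrow> ('a \<times> 'a) set" where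
  "length_class C a b = {(c, d). C a b c d}"

text \<open>The two assumptions make congruence an equivalence relation on pairs, so its classes can
  serve as the lengths of \<open>tarski_plane\<close>.\<close>

lemma length_class_eq:
  assumes A1: "\<And>a b. C a b b a" and A2: "\<And>a b p q r s. C a b p q \<Longrightarrow> C a b r s \<Longrightarrow> C p q r s"
  shows "C a b c d \<longleftrightarrow> length_class C a b = length_class C c d"
proof -
  have refl: "C a b a b" for a b by (rule A2[OF A1 A1])
  have sym: "C c d a b" if "C a b c d" for a b c d by (rule A2[OF that refl])
  have trans: "C a b e f" if "C a b c d" "C c d e f" for a b c d e f by (rule A2[OF sym that(2)]) (rule that)
  show ?thesis
  proof
    show "length_class C a b = length_class C c d" if "C a b c d"
      using that sym trans unfolding length_class_def by blast
    show "C a b c d" if "length_class C a b = length_class C c d"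
      using that refl[of c d] unfolding length_class_def by auto
  qed
qed

text \<open>One notion of model for both theories, in terms of non-strict betweenness: Tarski
  geometry is read with \<open>t\<close>, continuous Tarski geometry with
  \<open>strict_of t\<close>. The second clause recovers \<open>C\<close> from the lengths.\<close>

definition is_model :: "('a \<Rightarrow> 'a \<Rightarrow> 'a \<Rightarrow> bool) \<Rightarrow> ('a \<Rightarrow> 'a \<Rightarrow> 'a \<Rightarrow> 'a \<Rightarrow> bool) \<Rightarrow> bool" where
  "is_model t C \<longleftrightarrow> segment_circle_plane t (length_class C) \<and>
    (\<forall>a b c d. C a b c d \<longleftrightarrow> length_class C a b = length_class C c d)"

lemma tarski_is_model:
  assumes ax: "\<forall>\<gamma>\<in>tarski_geometry. sat UNIV (\<lambda>_. t) C e \<gamma>"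
  shows "is_model t C"
proof -
  note A1 = tarski_geometryD(1)[OF ax, unfolded sat_A1, rule_format, OF UNIV_I UNIV_I]
    and A2 = tarski_geometryD(2)[OF ax, unfolded sat_A2, rule_format, OF UNIV_I UNIV_I UNIV_I UNIV_I UNIV_I UNIV_I]
  have C: "C a b c d \<longleftrightarrow> length_class C a b = length_class C c d" for a b c d
    by (rule length_class_eq[OF A1 A2]) (rule conjI)
  note ax' = tarski_geometryD[OF ax, unfolded sat_A1 sat_A2 sat_A3 sat_A4 sat_A6 sat_A7
      sat_segment_circle sat_T ball_UNIV bex_UNIV, rule_format]
  have "segment_circle_plane t (length_class C)"
    unfolding segment_circle_plane_def segment_circle_plane_axioms_def tarski_plane_def C[symmetric]
  proof (intro conjI allI impI)
    show "C a b b a" for a b by (rule A1)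
    show "C a b c c \<Longrightarrow> a = b" for a b c by (rule ax'(3))
    show "\<exists>x. t q a x \<and> C a x b c" for q a b c by (rule ax'(4))
    show "C c d c' d'" if "a \<noteq> b" "t a b c" "t a' b' c'" "C a b a' b'" "C b c b' c'" "C a d a' d'" "C b d b' d'"
      for a b c d a' b' c' d' using ax'(5)[of a b c a' b' c' d d'] that by blast
    show "t a b a \<Longrightarrow> a = b" for a b by (rule ax'(6))
    show "t a p c \<Longrightarrow> t b q c \<Longrightarrow> \<exists>x. t p x b \<and> t q x a" for a p b q c
      by (rule ax'(7)) (rule conjI)
    show "\<exists>a b c. \<not> (t a b c \<or> t b c a \<or> t c a b)" by (rule ax'(8))
    show "t p q r \<or> t q r p \<or> t r p q" if "a \<noteq> b" "C p a p b" "C q a q b" "C r a r b" for p q r a b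
      using ax'(9)[of a b p q r] that by blast
    show "\<exists>x. C a x b x \<and> C a x c x" if "\<not> (t a b c \<or> t b c a \<or> t c a b)" for a b c
      using that by (rule ax'(10))
    show "\<exists>z. t p z q \<and> C a z a b" if "C a x a p" "t a x b" "t a b y" "C a y a q"
      for a b p q x y using ax'(11)[of a x p b y q] that by blast
  qed
  then show ?thesis using C unfolding is_model_def by blast
qed

lemma is_modelD: "is_model t C \<Longrightarrow> C a b c d \<longleftrightarrow> length_class C a b = length_class C c d"
  unfolding is_model_def by blast

lemma is_model_A2:
  assumes m: "is_model t C" and "C a b p q" "C a b r s"
  shows "C p q r s"
  using is_modelD[OF m, of a b p q] is_modelD[OF m, of a b r s] is_modelD[OF m, of p q r s] assms(2,3)
  by metis

lemma is_model_tarski: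
  assumes m: "is_model t C"
  shows "\<forall>\<gamma>\<in>tarski_geometry. sat UNIV (\<lambda>_. t) C e \<gamma>"
proof -
  interpret segment_circle_plane t "length_class C" using m unfolding is_model_def by blast
  note C = is_modelD[OF m]
  have "sat UNIV (\<lambda>_. t) C e (A1 :: tarski_fm)" unfolding sat_A1 ball_UNIV by (simp add: C D_comm)
  moreover have "sat UNIV (\<lambda>_. t) C e (A2 :: tarski_fm)" unfolding sat_A2
    by (intro ballI impI, elim conjE) (erule (1) is_model_A2[OF m])
  moreover have "sat UNIV (\<lambda>_. t) C e (A3 :: tarski_fm)"
    unfolding sat_A3 ball_UNIV by (simp only: C) (use D_zero in blast)
  moreover have "sat UNIV (\<lambda>_. t) C e A4"
    unfolding sat_A4 ball_UNIV bex_UNIV by (simp only: C) (use extend in blast)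
  moreover have "sat UNIV (\<lambda>_. t) C e (A5 (Btw T))"
    unfolding sat_T ball_UNIV by (simp only: C) (use five_seg in blast)
  moreover have "sat UNIV (\<lambda>_. t) C e A6"
    unfolding sat_A6 ball_UNIV using T_same by blast
  moreover have "sat UNIV (\<lambda>_. t) C e A7"
    unfolding sat_A7 ball_UNIV bex_UNIV using pasch by blast
  moreover have "sat UNIV (\<lambda>_. t) C e (A8 (Btw T))"
    unfolding sat_T ball_UNIV bex_UNIV using lower_dim by blast
  moreover have "sat UNIV (\<lambda>_. t) C e (A9 (Btw T))"
    unfolding sat_T ball_UNIV by (simp only: C) (use upper_dim in blast)
  moreover have "sat UNIV (\<lambda>_. t) C e (A10_3 (Btw T))"
    unfolding sat_T ball_UNIV bex_UNIV by (simp only: C) (use circumcenter in blast)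
  moreover have "sat UNIV (\<lambda>_. t) C e segment_circle"
    unfolding sat_segment_circle ball_UNIV bex_UNIV by (simp only: C) (use segment_circle in blast)
  ultimately show ?thesis unfolding tarski_geometry_def by simp
qed

text \<open>Strict inner Pasch is \<open>pasch_strict\<close>, and line-circle continuity is the
  main result on \<open>segment_circle_plane\<close>; the other axioms are already available in
  \<open>tarski_plane\<close>.\<close>

lemma is_model_continuous:
  assumes m: "is_model t C"
  shows "nonstrict_of (strict_of t) = t"
    "\<forall>\<gamma>\<in>continuous_tarski_geometry. sat UNIV (\<lambda>_. strict_of t) C e \<gamma>"
proof -
  interpret segment_circle_plane t "length_class C" using m unfolding is_model_def by blast
  note C = is_modelD[OF m]
  show t: "nonstrict_of (strict_of t) = t"
    by (intro ext) (use T_left T_right in \<open>auto simp: nonstrict_of_def strict_of_def\<close>)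
  let ?s = "sat UNIV (\<lambda>_. strict_of t) C e"
  have "?s (A1 :: continuous_fm)" unfolding sat_A1 ball_UNIV by (simp add: C D_comm)
  moreover have "?s (A2 :: continuous_fm)" unfolding sat_A2
    by (intro ballI impI, elim conjE) (erule (1) is_model_A2[OF m])
  moreover have "?s (A3 :: continuous_fm)"
    unfolding sat_A3 ball_UNIV by (simp only: C) (use D_zero in blast)
  moreover have "?s A4i"
    unfolding sat_A4i t ball_UNIV bex_UNIV by (simp only: C) (use extend in blast)
  moreover have "?s (A5 T_by_B)"
    unfolding sat_B t ball_UNIV by (simp only: C) (use five_seg in blast)
  moreover have "?s A6i"
    unfolding sat_A6i ball_UNIV strict_of_def using T_same by blast
  moreover have "?s A7i"
    unfolding sat_A7i t ball_UNIV bex_UNIV strict_of_def using pasch_strict unfolding Col_def by blast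
  moreover have "?s (A8 T_by_B)"
    unfolding sat_B t ball_UNIV bex_UNIV using lower_dim by blast
  moreover have "?s (A9 T_by_B)"
    unfolding sat_B t ball_UNIV by (simp only: C) (use upper_dim in blast)
  moreover have "?s (A10_3 T_by_B)"
    unfolding sat_B t ball_UNIV bex_UNIV by (simp only: C) (use circumcenter in blast)
  moreover have "?s A14i"
    unfolding sat_A14i ball_UNIV strict_of_def using T_sym by blast
  moreover have "?s A15i"
    unfolding sat_A15i ball_UNIV strict_of_def using T_inner by blast
  moreover have "?s line_circle"
    unfolding sat_line_circle t ball_UNIV bex_UNIV
    by (simp only: C collinear_def Col_def[symmetric]) (use line_circle in blast)
  ultimately show "\<forall>\<gamma>\<in>continuous_tarski_geometry. ?s \<gamma>"
    unfolding continuous_tarski_geometry_def by simp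
qed

text \<open>The strict axiom covers the proper case. If \<open>a\<close>, \<open>b\<close>,
  \<open>c\<close> are collinear, the middle one is the crossing; if a hypothesis is degenerate, it
  is one of \<open>a\<close>, \<open>b\<close>, \<open>p\<close>, \<open>q\<close>.\<close>

lemma nonstrict_pasch:
  assumes irrefl: "\<And>a b. \<not> \<beta> a b a" and sym: "\<And>a b c. \<beta> a b c \<Longrightarrow> \<beta> c b a"
    and inner: "\<And>a b c d. \<beta> a b d \<Longrightarrow> \<beta> b c d \<Longrightarrow> \<beta> a b c"
    and pasch: "\<And>a b c p q. \<lbrakk>\<beta> a p c; \<beta> b q c; \<not> collinear (nonstrict_of \<beta>) a b c\<rbrakk>
      \<Longrightarrow> \<exists>x. \<beta> p x b \<and> \<beta> q x a"
    and h: "nonstrict_of \<beta> a p c" "nonstrict_of \<beta> b q c"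
  shows "\<exists>x. nonstrict_of \<beta> p x b \<and> nonstrict_of \<beta> q x a"
proof -
  let ?t = "nonstrict_of \<beta>"
  have tsym: "?t c b a" if "?t a b c" for a b c
    using sym that unfolding nonstrict_of_def by blast
  have tinner: "?t a b c" if "?t a b d" "?t b c d" for a b c d
    using nonstrict_inner[of UNIV \<beta> a b c d] inner irrefl that by blast
  consider "?t a b c" | "?t b c a" | "?t c a b" | "a = p" | "p = c" | "b = q" | "q = c"
    | "\<beta> a p c" "\<beta> b q c" "\<not> collinear ?t a b c"
    using h unfolding collinear_def by (auto simp: nonstrict_of_def)
  then show ?thesis
  proof cases
    case 1
    then have "?t q b a" using tinner[of a b c q] h tsym by blast
    then show ?thesis using nonstrict_of_triv by metis
  next
    case 2
    have "?t b c p" using tinner[of b c a p] 2 tsym[OF h(1)] by blast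
    moreover have "?t a c q" using tinner[of a c b q] tsym[OF 2] tsym[OF h(2)] by blast
    ultimately show ?thesis using tsym by blast
  next
    case 3
    have "?t b a p" using tinner[of b a c p] tsym[OF 3] h by blast
    then show ?thesis using tsym nonstrict_of_triv by metis
  next
    case 4
    then show ?thesis using nonstrict_of_triv by metis
  next
    case 5
    then show ?thesis using tsym[OF h(2)] nonstrict_of_triv by metis
  next
    case 6
    then show ?thesis using nonstrict_of_triv by metis
  next
    case 7
    then show ?thesis using tsym[OF h(1)] nonstrict_of_triv by metis
  next
    case 8
    then show ?thesis using pasch[of a p c b q] unfolding nonstrict_of_def by blast
  qed
qed

lemma continuous_is_model:
  assumes ax: "\<forall>\<gamma>\<in>continuous_tarski_geometry. sat UNIV (\<lambda>_. \<beta>) C e \<gamma>"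
  shows "strict_of (nonstrict_of \<beta>) = \<beta>" "is_model (nonstrict_of \<beta>) C"
proof -
  let ?t = "nonstrict_of \<beta>"
  note ax' = continuous_tarski_geometryD[OF ax, unfolded sat_A1 sat_A2 sat_A3 sat_A4i sat_A6i sat_A7i
      sat_A14i sat_A15i sat_line_circle sat_B ball_UNIV bex_UNIV, rule_format]
  note A1 = ax'(1) and A2 = ax'(2)
  have C: "C a b c d \<longleftrightarrow> length_class C a b = length_class C c d" for a b c d
    by (rule length_class_eq[OF A1 A2]) (rule conjI)
  note irrefl = ax'(6) and sym = ax'(11)
  have inner: "\<beta> a b c" if "\<beta> a b d" "\<beta> b c d" for a b c d using ax'(12) that by blast
  have strict_pasch: "\<exists>x. \<beta> p x b \<and> \<beta> q x a"
    if "\<beta> a p c" "\<beta> b q c" "\<not> collinear ?t a b c" for a b c p q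
    using ax'(7)[of a p c b q] that unfolding collinear_def by blast
  \<comment> \<open>Inner transitivity would turn \<open>\<beta> a a c\<close> into
    \<open>\<beta> a a a\<close>. So \<open>\<beta>\<close> is strict and can be recovered from its
    non-strict form.\<close>
  have left: "\<not> \<beta> a a c" for a c using inner[of a a c a] irrefl by blast
  have right: "\<not> \<beta> a c c" for a c using sym[of a c c] left[of c a] by blast
  show "strict_of ?t = \<beta>"
    using left right by (intro ext) (auto simp: nonstrict_of_def strict_of_def)
  obtain u v w where "\<not> ?t u v w" using ax'(8) by blast
  then have uv: "u \<noteq> v" by auto
  have plane: "tarski_plane ?t (length_class C)"
    unfolding tarski_plane_def C[symmetric]
  proof (intro conjI allI impI)
    show "C a b b a" for a b by (rule A1)
    show "C a b c c \<Longrightarrow> a = b" for a b c by (rule ax'(3))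
    show "\<exists>x. ?t q a x \<and> C a x b c" for q a b c
    proof (cases "q = a")
      case True
      \<comment> \<open>\<open>A4i\<close> excludes \<open>q = a\<close>. Extending from any other
        point \<open>r\<close> gives a point at the right distance, and \<open>?t a a x\<close> is
        trivial.\<close>
      obtain r where "r \<noteq> a" using uv by metis
      then obtain x where "C a x b c" using ax'(4)[of r a b c] by blast
      then show ?thesis using True by auto
    qed (rule ax'(4))
    show "C c d c' d'" if "a \<noteq> b" "?t a b c" "?t a' b' c'" "C a b a' b'" "C b c b' c'" "C a d a' d'" "C b d b' d'"
      for a b c d a' b' c' d' using ax'(5)[of a b c a' b' c' d d'] that by blast
    show "?t a b a \<Longrightarrow> a = b" for a b using irrefl[of a b] by (auto simp: nonstrict_of_def)
    show "?t a p c \<Longrightarrow> ?t b q c \<Longrightarrow> \<exists>x. ?t p x b \<and> ?t q x a" for a p b q c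
      by (rule nonstrict_pasch[OF irrefl sym inner strict_pasch])
    show "\<exists>a b c. \<not> (?t a b c \<or> ?t b c a \<or> ?t c a b)" by (rule ax'(8))
    show "?t p q r \<or> ?t q r p \<or> ?t r p q" if "a \<noteq> b" "C p a p b" "C q a q b" "C r a r b" for p q r a b
      using ax'(9)[of a b p q r] that by blast
    show "\<exists>x. C a x b x \<and> C a x c x" if "\<not> (?t a b c \<or> ?t b c a \<or> ?t c a b)" for a b c
      using that by (rule ax'(10))
  qed
  interpret tarski_plane ?t "length_class C" by (rule plane)
  interpret line_circle_plane ?t "length_class C"
  proof
    show "\<exists>y z. Col u v y \<and> Col u v z \<and> length_class C a y = length_class C a b \<and>
        length_class C a z = length_class C a b \<and> ?t y p z \<and> (p \<noteq> b \<longrightarrow> y \<noteq> z)"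
      if "Col u v p" "u \<noteq> v" "?t a p b" for u v p a b
      using ax'(13)[of u v p a b] that unfolding C[symmetric] Col_def collinear_def by blast
  qed
  have "segment_circle_plane ?t (length_class C)"
    by unfold_locales (rule segment_circle)
  then show "is_model ?t C" using C unfolding is_model_def by blast
qed

section \<open>Transfer of theorems by soundness and completeness\<close>

theorem theorem6p1:
  shows "(\<forall>\<phi> :: tarski_fm.
            (tarski_geometry \<turnstile> \<phi>) \<longleftrightarrow> (continuous_tarski_geometry \<turnstile> to_B \<phi>)) \<and>
         (\<forall>\<psi> :: continuous_fm.
            (continuous_tarski_geometry \<turnstile> \<psi>) \<longleftrightarrow> (tarski_geometry \<turnstile> to_T \<psi>))"
proof -
  \<comment> \<open>There is one relation symbol, so an interpretation is a single ternary
    relation.\<close>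
  have RT: "R = (\<lambda>_. R T)" for R :: "nonstrict \<Rightarrow> nat \<Rightarrow> nat \<Rightarrow> nat \<Rightarrow> bool"
    by (rule ext) (metis nonstrict.exhaust)
  have RB: "R = (\<lambda>_. R B)" for R :: "strict \<Rightarrow> nat \<Rightarrow> nat \<Rightarrow> nat \<Rightarrow> bool"
    by (rule ext) (metis strict.exhaust)
  \<comment> \<open>By completeness, what holds in all structures of the common class
    \<open>is_model\<close> is provable, in this theory and likewise in the other one.\<close>
  have completeT: "tarski_geometry \<turnstile> \<phi>"
    if h: "\<And>t C (e :: nat \<Rightarrow> nat). is_model t C \<Longrightarrow> sat UNIV (\<lambda>_. t) C e \<phi>" for \<phi>
  proof (rule completeness)
    show "finite tarski_geometry" by (simp add: tarski_geometry_def)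
    show "infinite U" if "\<forall>\<gamma>\<in>tarski_geometry. sat U R C e \<gamma>" for U :: "nat set" and R C e
      using tarski_infinite that RT[of R] by metis
    show "sat UNIV R C e \<phi>" if "\<forall>\<gamma>\<in>tarski_geometry. sat UNIV R C e \<gamma>" for R C and e :: "nat \<Rightarrow> nat"
      using h tarski_is_model that RT[of R] by metis
  qed
  have completeB: "continuous_tarski_geometry \<turnstile> \<psi>"
    if h: "\<And>t C (e :: nat \<Rightarrow> nat). is_model t C \<Longrightarrow> sat UNIV (\<lambda>_. strict_of t) C e \<psi>" for \<psi>
  proof (rule completeness)
    show "finite continuous_tarski_geometry" by (simp add: continuous_tarski_geometry_def)
    show "infinite U" if "\<forall>\<gamma>\<in>continuous_tarski_geometry. sat U R C e \<gamma>" for U :: "nat set" and R C e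
      using continuous_infinite that RB[of R] by metis
    show "sat UNIV R C e \<psi>" if "\<forall>\<gamma>\<in>continuous_tarski_geometry. sat UNIV R C e \<gamma>"
      for R C and e :: "nat \<Rightarrow> nat"
      using h continuous_is_model that RB[of R] by metis
  qed
  have soundT: "sat UNIV (\<lambda>_. t) C e \<phi>" if "tarski_geometry \<turnstile> \<phi>" "is_model t C"
    for \<phi> t C and e :: "nat \<Rightarrow> nat"
    using soundness[OF that(1)] is_model_tarski[OF that(2)] by blast
  have soundB: "sat UNIV (\<lambda>_. strict_of t) C e \<psi>" if "continuous_tarski_geometry \<turnstile> \<psi>" "is_model t C"
    for \<psi> t C and e :: "nat \<Rightarrow> nat"
    using soundness[OF that(1)] is_model_continuous(2)[OF that(2)] by blast
  \<comment> \<open>Passing to \<open>strict_of t\<close> and back gives \<open>t\<close> again, so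
    the translation preserves truth.\<close>
  have to_B: "sat UNIV (\<lambda>_. strict_of t) C e (to_B \<phi>) \<longleftrightarrow> sat UNIV (\<lambda>_. t) C e \<phi>"
    if "is_model t C" for \<phi> t C and e :: "nat \<Rightarrow> nat"
    by (simp only: sat_to_B is_model_continuous(1)[OF that])
  show ?thesis
  proof (intro conjI allI iffI)
    fix \<phi>
    show "continuous_tarski_geometry \<turnstile> to_B \<phi>" if "tarski_geometry \<turnstile> \<phi>"
      by (rule completeB) (simp only: to_B soundT[OF that])
    show "tarski_geometry \<turnstile> \<phi>" if "continuous_tarski_geometry \<turnstile> to_B \<phi>"
      by (rule completeT) (use soundB[OF that] to_B in blast)
  next
    fix \<psi>
    show "tarski_geometry \<turnstile> to_T \<psi>" if "continuous_tarski_geometry \<turnstile> \<psi>"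
      by (rule completeT) (simp only: sat_to_T soundB[OF that])
    show "continuous_tarski_geometry \<turnstile> \<psi>" if "tarski_geometry \<turnstile> to_T \<psi>"
      by (rule completeB) (simp only: sat_to_T[symmetric] soundT[OF that])
  qed
qed

end
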